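(* Let $(X,\|\cdot\|_X)$ be a reflexive real Banach space and let $\Psi\in\Gamma_G(X)$ be strictly convex on $\mathrm{int\,dom}\,\Psi$ and Euler--Legendre. Then: (i) if $T:X\to2^{X^*}$ is monotone and $\mathrm{ran}(D\Psi)\subseteq\mathrm{ran}(D\Psi+T)$, then the right resolvent $\overrightarrow{\mathrm{res}}^\Psi_T$ is single-valued on its domain $\mathrm{dom}(\overrightarrow{\mathrm{res}}^\Psi_T)\subseteq\mathrm{int\,dom}\,\Psi^*$, and $$D_{\Psi^*}(x,y)\ge D_{\Psi^*}(x,\overrightarrow{\mathrm{res}}^\Psi_T(x))+D_{\Psi^*}(\overrightarrow{\mathrm{res}}^\Psi_T(x),y)\quad\forall(x,y)\in\mathrm{int\,dom}\,\Psi^*\times\mathrm{Fix}(\overrightarrow{\mathrm{res}}^\Psi_T),$$ with $\mathrm{Fix}(\overrightarrow{\mathrm{res}}^\Psi_T)=D\Psi(\mathrm{int\,dom}\,\Psi\cap T^{-1}(0))$; (ii) if $T:X\to2^{X^*}$ is maximally monotone, $\mathrm{dom}(T)\subseteq\mathrm{int\,dom}\,\Psi$, $\mathrm{dom}\,\Psi^*=X^*$, and $\lambda\in\,]0,\infty[$, then $\overrightarrow{\mathrm{res}}^\Psi_{\lambda T}$ is single-valued on its domain $\mathrm{dom}(\overrightarrow{\mathrm{res}}^\Psi_{\lambda T})\subseteq\mathrm{int\,dom}\,\Psi^*$, and $$D_{\Psi^*}(x,y)\ge D_{\Psi^*}(x,\overrightarrow{\mathrm{res}}^\Psi_{\lambda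 T}(x))+D_{\Psi^*}(\overrightarrow{\mathrm{res}}^\Psi_{\lambda T}(x),y)\quad\forall(x,y)\in\mathrm{int\,dom}\,\Psi^*\times\mathrm{Fix}(\overrightarrow{\mathrm{res}}^\Psi_{\lambda T}),$$ with $\mathrm{Fix}(\overrightarrow{\mathrm{res}}^\Psi_{\lambda T})=D\Psi(\mathrm{int\,dom}\,\Psi\cap T^{-1}(0))$.
   Context: $\langle\cdot,\cdot\rangle$ is the pairing of $X\times X^*$; $X^{**}=X$ by reflexivity. For $\Psi:X\to\,]-\infty,\infty]$, $\mathrm{dom}\,\Psi=\{x:\Psi(x)\neq\infty\}$ and $\mathrm{int\,dom}\,\Psi$ is its norm interior. $\Gamma_G(X)$ is the set of proper convex lower semicontinuous $\Psi:X\to\,]-\infty,\infty]$ with $\mathrm{int\,dom}\,\Psi\neq\varnothing$ that are Gateaux differentiable on $\mathrm{int\,dom}\,\Psi$, with derivative $D\Psi$ (defined on $\mathrm{int\,dom}\,\Psi$, regarded as a set-valued map with empty value elsewhere). $\Psi^*$ is the convex conjugate on $X^*$. Essentially Gateaux differentiable: $\mathrm{int\,dom}\,\Psi\neq\varnothing$ and the subdifferential $\partial\Psi(x)$ is a singleton whenever nonempty. Essentially strictly convex: $\Psi$ is strictly convex on every convex subset of $\{x:\partial\Psi(x)\ne\varnothing\}$ and $(\partial\Psi)^{-1}$ is locally bounded on its domain. Euler--Legendre: both. (For reflexive $X$ and Euler--Legendre $\Psi$, $D\Psi:\mathrm{int\,dom}\,\Psi\to\mathrm{int\,dom}\,\Psi^*$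 is a bijection with inverse $D\Psi^*$.) $D_{\Psi^*}(x,y)=\Psi^*(x)-\Psi^*(y)-\langle D\Psi^*(y),x-y\rangle$ for $x\in X^*$, $y\in\mathrm{int\,dom}\,\Psi^*$. For $T:X\to2^{X^*}$ (with nonempty graph): $\mathrm{dom}(T)=\{x:T(x)\neq\varnothing\}$, $\mathrm{ran}(T)=\bigcup_xT(x)$, $T^{-1}(y)=\{x:y\in T(x)\}$; $T$ is monotone iff $\langle x-y,v-w\rangle\ge0$ for all $v\in T(x)$, $w\in T(y)$; maximally monotone iff monotone and its graph is not properly contained in the graph of another monotone map. The right $D_\Psi$-resolvent is $\overrightarrow{\mathrm{res}}^\Psi_{\lambda T}=(\mathrm{id}_{X^*}+\lambda T\circ D\Psi^* )^{-1}:X^*\to2^{X^*}$ (inverse of a set-valued map). $\mathrm{Fix}(S)=\{x:S(x)=x\}$.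
   Formalization: In (i), dom(res_T) ⊆ int dom Ψ* is claimed only when ran(DΨ+T) ⊆ ran(DΨ), as it fails otherwise (Ψ(x) = −ln(−x) for x<0, ∞ otherwise, T ≡ {−1}); instead int dom Ψ* ⊆ dom(res_T) and ran(res_T) ⊆ int dom Ψ* are proved. *)

theory Defs
  imports "HOL-Analysis.Analysis"
begin

section \<open>Duality\<close>

text \<open>The dual of \<open>X = 'a\<close> is \<open>'a \<Rightarrow>\<^sub>L real\<close>, and the pairing of \<open>x\<close> and \<open>v\<close> is \<open>blinfun_apply v x\<close>.\<close>

definition canonical_embedding ::
    "'a::real_normed_vector \<Rightarrow> (('a \<Rightarrow>\<^sub>L real) \<Rightarrow>\<^sub>L real)" where
  "canonical_embedding x = Blinfun (\<lambda>v. blinfun_apply v x)"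

lemma canonical_embedding_apply [simp]:
  "blinfun_apply (canonical_embedding x) v = blinfun_apply v x"
  unfolding canonical_embedding_def
  by (simp add: bounded_linear_Blinfun_apply blinfun.bounded_linear_left)

definition reflexive_space :: "'a::real_normed_vector itself \<Rightarrow> bool" where
  "reflexive_space _ \<longleftrightarrow>
     surj (canonical_embedding :: 'a \<Rightarrow> (('a \<Rightarrow>\<^sub>L real) \<Rightarrow>\<^sub>L real))"


section \<open>Set-valued maps\<close>

definition sv_dom :: "('a \<Rightarrow> 'b set) \<Rightarrow> 'a set" where
  "sv_dom T = {x. T x \<noteq> {}}"

definition sv_ran :: "('a \<Rightarrow> 'b set) \<Rightarrow> 'b set" where
  "sv_ran T = (\<Union>x. T x)"

definition sv_graph :: "('a \<Rightarrow> 'b set) \<Rightarrow> ('a \<times> 'b) set" where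
  "sv_graph T = {(x, y). y \<in> T x}"

definition sv_inv :: "('a \<Rightarrow> 'b set) \<Rightarrow> 'b \<Rightarrow> 'a set" where
  "sv_inv T y = {x. y \<in> T x}"

definition sv_image :: "('a \<Rightarrow> 'b set) \<Rightarrow> 'a set \<Rightarrow> 'b set" where
  "sv_image T A = (\<Union>x\<in>A. T x)"

definition sv_comp :: "('b \<Rightarrow> 'c set) \<Rightarrow> ('a \<Rightarrow> 'b set) \<Rightarrow> 'a \<Rightarrow> 'c set" where
  "sv_comp T S x = (\<Union>y\<in>S x. T y)"

definition sv_add :: "('a \<Rightarrow> 'b::plus set) \<Rightarrow> ('a \<Rightarrow> 'b set) \<Rightarrow> 'a \<Rightarrow> 'b set" where
  "sv_add S T x = {v + w | v w. v \<in> S x \<and> w \<in> T x}"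

definition sv_scale :: "real \<Rightarrow> ('a \<Rightarrow> 'b::real_vector set) \<Rightarrow> 'a \<Rightarrow> 'b set" where
  "sv_scale c T x = (\<lambda>v. c *\<^sub>R v) ` T x"

definition sv_Fix :: "('a \<Rightarrow> 'a set) \<Rightarrow> 'a set" where
  "sv_Fix S = {x. S x = {x}}"

definition single_valued_on_dom :: "('a \<Rightarrow> 'b set) \<Rightarrow> bool" where
  "single_valued_on_dom T \<longleftrightarrow> (\<forall>x\<in>sv_dom T. \<exists>y. T x = {y})"

definition locally_bounded_on ::
    "'a::topological_space set \<Rightarrow> ('a \<Rightarrow> 'b::metric_space set) \<Rightarrow> bool" where
  "locally_bounded_on A T \<longleftrightarrow> (\<forall>x\<in>A. \<exists>U. open U \<and> x \<in> U \<and> bounded (sv_image T U))"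

definition sv_monotone :: "('a::real_normed_vector \<Rightarrow> ('a \<Rightarrow>\<^sub>L real) set) \<Rightarrow> bool" where
  "sv_monotone T \<longleftrightarrow> (\<forall>x y. \<forall>v\<in>T x. \<forall>w\<in>T y. 0 \<le> blinfun_apply (v - w) (x - y))"

definition maximally_monotone ::
    "('a::real_normed_vector \<Rightarrow> ('a \<Rightarrow>\<^sub>L real) set) \<Rightarrow> bool" where
  "maximally_monotone T \<longleftrightarrow>
     sv_monotone T \<and> \<not> (\<exists>S. sv_monotone S \<and> sv_graph T \<subset> sv_graph S)"


section \<open>Convex functions\<close>

definition edom :: "('a \<Rightarrow> ereal) \<Rightarrow> 'a set" where
  "edom f = {x. f x \<noteq> \<infinity>}"

definition proper_fun :: "('a \<Rightarrow> ereal) \<Rightarrow> bool" where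
  "proper_fun f \<longleftrightarrow> (\<forall>x. f x \<noteq> -\<infinity>) \<and> edom f \<noteq> {}"

definition econvex :: "('a::real_vector \<Rightarrow> ereal) \<Rightarrow> bool" where
  "econvex f \<longleftrightarrow> (\<forall>x y t. 0 < t \<longrightarrow> t < 1 \<longrightarrow>
     f ((1 - t) *\<^sub>R x + t *\<^sub>R y) \<le> ereal (1 - t) * f x + ereal t * f y)"

definition strictly_econvex_on :: "'a::real_vector set \<Rightarrow> ('a \<Rightarrow> ereal) \<Rightarrow> bool" where
  "strictly_econvex_on C f \<longleftrightarrow>
     (\<forall>x\<in>C. \<forall>y\<in>C. \<forall>t. x \<noteq> y \<longrightarrow> 0 < t \<longrightarrow> t < 1 \<longrightarrow>
        f ((1 - t) *\<^sub>R x + t *\<^sub>R y) < ereal (1 - t) * f x + ereal t * f y)"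

definition lsc :: "('a::topological_space \<Rightarrow> ereal) \<Rightarrow> bool" where
  "lsc f \<longleftrightarrow> (\<forall>c. open {x. c < f x})"

definition conjugate ::
    "('a::real_normed_vector \<Rightarrow> ereal) \<Rightarrow> ('a \<Rightarrow>\<^sub>L real) \<Rightarrow> ereal" where
  "conjugate f v = (SUP x. ereal (blinfun_apply v x) - f x)"

definition subdiff ::
    "('a::real_normed_vector \<Rightarrow> ereal) \<Rightarrow> 'a \<Rightarrow> ('a \<Rightarrow>\<^sub>L real) set" where
  "subdiff f x = {v. x \<in> edom f \<and> (\<forall>z. f x + ereal (blinfun_apply v (z - x)) \<le> f z)}"

text \<open>The Gateaux derivative as a set-valued map: it has at most one value, and it is empty
  outside the interior of the domain. The passage to real values in the difference quotient is
  harmless, since a proper function is finite near such a point.\<close>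

definition gateaux ::
    "('a::real_normed_vector \<Rightarrow> ereal) \<Rightarrow> 'a \<Rightarrow> ('a \<Rightarrow>\<^sub>L real) set" where
  "gateaux f x = {v. x \<in> interior (edom f) \<and>
     (\<forall>h. ((\<lambda>t. (real_of_ereal (f (x + t *\<^sub>R h)) - real_of_ereal (f x)) / t)
            \<longlongrightarrow> blinfun_apply v h) (at 0))}"

text \<open>For a function on the dual, the derivative lies in the bidual; this is its representation
  by elements of \<open>X\<close>, via the identification of \<open>X\<close> with its bidual.\<close>

definition dual_gateaux ::
    "(('a::real_normed_vector \<Rightarrow>\<^sub>L real) \<Rightarrow> ereal) \<Rightarrow> ('a \<Rightarrow>\<^sub>L real) \<Rightarrow> 'a set" where
  "dual_gateaux g y = {x. canonical_embedding x \<in> gateaux g y}"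

definition Gamma_G :: "('a::real_normed_vector \<Rightarrow> ereal) set" where
  "Gamma_G = {f. proper_fun f \<and> econvex f \<and> lsc f \<and> interior (edom f) \<noteq> {} \<and>
     (\<forall>x\<in>interior (edom f). gateaux f x \<noteq> {})}"

definition essentially_gateaux :: "('a::real_normed_vector \<Rightarrow> ereal) \<Rightarrow> bool" where
  "essentially_gateaux f \<longleftrightarrow> interior (edom f) \<noteq> {} \<and> single_valued_on_dom (subdiff f)"

definition essentially_strictly_convex :: "('a::real_normed_vector \<Rightarrow> ereal) \<Rightarrow> bool" where
  "essentially_strictly_convex f \<longleftrightarrow>
     (\<forall>C. convex C \<and> C \<subseteq> sv_dom (subdiff f) \<longrightarrow> strictly_econvex_on C f) \<and>
     locally_bounded_on (sv_dom (sv_inv (subdiff f))) (sv_inv (subdiff f))"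

definition Euler_Legendre :: "('a::real_normed_vector \<Rightarrow> ereal) \<Rightarrow> bool" where
  "Euler_Legendre f \<longleftrightarrow> essentially_gateaux f \<and> essentially_strictly_convex f"


section \<open>Bregman functional and right resolvent\<close>

text \<open>The functional \<open>D\<^sub>g\<close> for \<open>g\<close> on the dual; meaningful only at points \<open>y\<close> at which \<open>g\<close> is
  Gateaux differentiable.\<close>

definition dual_bregman ::
    "(('a::real_normed_vector \<Rightarrow>\<^sub>L real) \<Rightarrow> ereal) \<Rightarrow> ('a \<Rightarrow>\<^sub>L real) \<Rightarrow> ('a \<Rightarrow>\<^sub>L real) \<Rightarrow> ereal"
  where
  "dual_bregman g x y =
     g x - g y - ereal (blinfun_apply (x - y) (the_elem (dual_gateaux g y)))"

text \<open>The right resolvent \<open>(id + T \<circ> D\<Psi>\<^sup>*)\<^sup>-\<^sup>1\<close>. Since \<open>D\<Psi>\<^sup>*\<close> is empty-valued outside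
  \<open>int dom \<Psi>\<^sup>*\<close>, the \<^emph>\<open>values\<close> of the resolvent lie in \<open>int dom \<Psi>\<^sup>*\<close>, but its domain need not.
  For instance, let \<open>\<Psi> x = - ln (- x)\<close> for real \<open>x < 0\<close> (and \<open>\<infinity>\<close> otherwise), so that \<open>int dom \<Psi>\<^sup>*\<close>
  is the open positive half-line, and let \<open>T\<close> be constantly \<open>{-1}\<close>: then
  \<open>ran D\<Psi> \<subseteq> ran (D\<Psi> + T)\<close>, and the resolvent is \<open>x \<mapsto> x + 1\<close> with domain \<open>x > -1\<close>.
  In general the domain is \<open>ran (D\<Psi> + T)\<close>.\<close>

definition right_resolvent ::
    "('a::real_normed_vector \<Rightarrow> ereal) \<Rightarrow> ('a \<Rightarrow> ('a \<Rightarrow>\<^sub>L real) set) \<Rightarrow>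
     ('a \<Rightarrow>\<^sub>L real) \<Rightarrow> ('a \<Rightarrow>\<^sub>L real) set" where
  "right_resolvent \<Psi> T =
     sv_inv (sv_add (\<lambda>y. {y}) (sv_comp T (dual_gateaux (conjugate \<Psi>))))"

end

theory Submission
  imports Defs
begin

text \<open>A point \<open>p\<close> is a value of the right resolvent of \<open>T\<close> at \<open>x\<close> iff \<open>p = D\<Psi> z\<close> and \<open>x - p \<in> T z\<close> for
  some \<open>z\<close>. This rests on \<open>D\<Psi> : int dom \<Psi> \<rightarrow> int dom \<Psi>\<^sup>*\<close> being a bijection with inverse \<open>D\<Psi>\<^sup>*\<close>;
  essential Gateaux differentiability keeps subgradients away from the boundary of \<open>dom \<Psi>\<close>, and
  local boundedness of \<open>(\<partial>\<Psi>)\<inverse>\<close> makes the range of \<open>\<partial>\<Psi>\<close> open. The three-point identity then reduces the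
  Bregman inequality to one instance of the monotonicity of \<open>T\<close>. For maximally monotone \<open>T\<close> the
  range condition is proved by Fenchel duality with the Fitzpatrick function of \<open>T\<close>. All duality
  arguments use one sandwich theorem, and reflexivity represents its functionals by points of \<open>X\<close>.\<close>

section \<open>The Hahn--Banach theorem and separation\<close>

text \<open>Each use of \<open>sandwich\<close> needs one ball on which the upper function is
  bounded above, and in infinite dimension a convex function may be finite near a point yet
  unbounded there. For lower semicontinuous functions on a complete space Baire category closes this
  gap; conjugates are such functions, since a dual space is complete. In the surjectivity argument
  the ball sits at a graph point \<open>(a, a')\<close> of \<open>T\<close>: the inclusion of
  \<open>sv_dom T\<close> in \<open>interior (edom \<Psi>)\<close> makes \<open>a\<close> interior,
  and \<open>edom (conjugate \<Psi>) = UNIV\<close> makes \<open>w - a'\<close> interior for every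
  target \<open>w\<close>. Reflexivity also takes the place of weak compactness: a subgradient of
  \<open>conjugate f\<close> at \<open>w\<close> is a point of the space, and that point minimises
  \<open>f - w\<close>. The domain of the resolvent is the range of the sum of
  \<open>gateaux \<Psi>\<close> and \<open>T\<close>, while the range of
  \<open>gateaux \<Psi>\<close> is \<open>interior (edom (conjugate \<Psi>))\<close>. The range
  condition thus says exactly that the resolvent is defined on that whole interior.\<close>

definition sublinear :: "('a::real_vector \<Rightarrow> real) \<Rightarrow> bool" where
  "sublinear p \<longleftrightarrow> (\<forall>x y. p (x + y) \<le> p x + p y) \<and> (\<forall>s>0. \<forall>x. p (s *\<^sub>R x) = s * p x)"

lemma sublinear_add: "sublinear p \<Longrightarrow> p (x + y) \<le> p x + p y"
  and sublinear_scale: "sublinear p \<Longrightarrow> s > 0 \<Longrightarrow> p (s *\<^sub>R x) = s * p x"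
  by (auto simp: sublinear_def)

lemma sublinear_zero: "sublinear p \<Longrightarrow> p 0 = 0"
  using sublinear_scale[of p 2 0] by simp

lemma sublinear_minus_le: "sublinear p \<Longrightarrow> - p (- x) \<le> p x"
  using sublinear_add[of p x "- x"] sublinear_zero[of p] by simp

text \<open>A minimal sublinear functional \<open>q\<close> is additive because \<open>\<lambda>x. INF t\<ge>0. q (x + t y) - t q y\<close>
  is sublinear and lies below \<open>q\<close>, hence equals \<open>q\<close>, for every \<open>y\<close>.\<close>

lemma sublinear_directional_le:
  fixes q :: "'a::real_vector \<Rightarrow> real"
  assumes q: "sublinear q"
  defines "q' \<equiv> \<lambda>y x. INF t\<in>{0..}. q (x + t *\<^sub>R y) - t * q y"
  shows "sublinear (q' y)" "q' y x \<le> q x" "q' y (- y) \<le> - q y"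
proof -
  have lower: "- q (- x) \<le> q (x + t *\<^sub>R y) - t * q y" if "t \<ge> 0" for x t
  proof -
    have "t * q y = q (t *\<^sub>R y)"
      using that sublinear_scale[OF q] sublinear_zero[OF q] by (cases "t = 0") auto
    also have "\<dots> \<le> q (x + t *\<^sub>R y) + q (- x)"
      using sublinear_add[OF q, of "x + t *\<^sub>R y" "- x"] by simp
    finally show ?thesis by simp
  qed
  then have bdd: "bdd_below ((\<lambda>t. q (x + t *\<^sub>R y) - t * q y) ` {0..})" for x
    by (intro bdd_belowI2[of _ "- q (- x)"]) auto
  have le: "q' y x \<le> q (x + t *\<^sub>R y) - t * q y" if "t \<ge> 0" for x t
    unfolding q'_def using that by (intro cINF_lower bdd) auto
  have ge: "c \<le> q' y x" if "\<And>t. t \<ge> 0 \<Longrightarrow> c \<le> q (x + t *\<^sub>R y) - t * q y" for c x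
    unfolding q'_def using that by (intro cINF_greatest) auto
  show "q' y x \<le> q x" using le[of 0 x] by simp
  show "q' y (- y) \<le> - q y" using le[of 1 "- y"] sublinear_zero[OF q] by simp
  have scale: "s * q' y x \<le> q' y (s *\<^sub>R x)" if "s > 0" for s x
  proof (rule ge)
    fix t :: real assume "t \<ge> 0"
    then have "s * q' y x \<le> s * (q (x + (t / s) *\<^sub>R y) - (t / s) * q y)"
      using that by (intro mult_left_mono le) auto
    also have "\<dots> = q (s *\<^sub>R (x + (t / s) *\<^sub>R y)) - t * q y"
      using that by (simp only: sublinear_scale[OF q that]) (simp add: field_simps)
    also have "s *\<^sub>R (x + (t / s) *\<^sub>R y) = s *\<^sub>R x + t *\<^sub>R y"
      using that by (simp add: algebra_simps)
    finally show "s * q' y x \<le> q (s *\<^sub>R x + t *\<^sub>R y) - t * q y" .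
  qed
  show "sublinear (q' y)"
    unfolding sublinear_def
  proof (intro conjI allI impI)
    fix x z
    have *: "q' y (x + z) \<le> q (x + t *\<^sub>R y) - t * q y + (q (z + u *\<^sub>R y) - u * q y)"
      if "t \<ge> 0" "u \<ge> 0" for t u
    proof -
      have "q' y (x + z) \<le> q ((x + z) + (t + u) *\<^sub>R y) - (t + u) * q y"
        using that by (intro le) auto
      also have "(x + z) + (t + u) *\<^sub>R y = (x + t *\<^sub>R y) + (z + u *\<^sub>R y)"
        by (simp add: algebra_simps)
      finally show ?thesis
        using sublinear_add[OF q, of "x + t *\<^sub>R y" "z + u *\<^sub>R y"] by (simp add: algebra_simps)
    qed
    have "q' y (x + z) - (q (x + t *\<^sub>R y) - t * q y) \<le> q' y z" if "t \<ge> 0" for t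
      using *[OF that] by (intro ge) (simp add: diff_le_eq add.commute)
    then have "q' y (x + z) - q' y z \<le> q' y x"
      by (intro ge) (simp add: diff_le_eq add.commute)
    then show "q' y (x + z) \<le> q' y x + q' y z" by simp
  next
    fix s :: real and x assume s: "s > 0"
    have "inverse s * q' y (s *\<^sub>R x) \<le> q' y x"
      using scale[of "inverse s" "s *\<^sub>R x"] s by simp
    then have "q' y (s *\<^sub>R x) \<le> s * q' y x"
      using s by (simp add: field_simps)
    with scale[OF s, of x] show "q' y (s *\<^sub>R x) = s * q' y x" by simp
  qed
qed

lemma ex_minimal_sublinear:
  fixes p :: "'a::real_vector \<Rightarrow> real"
  assumes p: "sublinear p"
  obtains q where "sublinear q" "q \<le> p" "\<And>q'. sublinear q' \<Longrightarrow> q' \<le> q \<Longrightarrow> q' = q"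
proof -
  define A where "A = {q. sublinear q \<and> q \<le> p}"
  have "\<exists>m\<in>A. \<forall>a\<in>A. a \<le> m \<longrightarrow> a = m"
  proof (rule predicate_Zorn)
    show "partial_order_on A (relation_of (\<lambda>x y. y \<le> x) A)"
      by (rule partial_order_on_relation_ofI) auto
  next
    fix C assume "C \<in> Chains (relation_of (\<lambda>x y. y \<le> x) A)"
    then have sub: "C \<subseteq> A" and chain: "\<And>a b. a \<in> C \<Longrightarrow> b \<in> C \<Longrightarrow> a \<le> b \<or> b \<le> a"
      by (auto simp: Chains_def relation_of_def)
    show "\<exists>u\<in>A. \<forall>a\<in>C. u \<le> a"
    proof (cases "C = {}")
      case True
      then show ?thesis using p by (auto simp: A_def)
    next
      case False
      define u where "u x = (INF c\<in>C. c x)" for x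
      \<comment> \<open>Sublinearity gives \<open>- c (- x) \<le> c x\<close>, and
        \<open>c \<le> p\<close> at \<open>- x\<close> makes the lower bound independent of
        \<open>c\<close>.\<close>
      have "bdd_below ((\<lambda>c. c x) ` C)" for x
      proof (rule bdd_belowI2)
        fix c assume "c \<in> C"
        then have "sublinear c" "c (- x) \<le> p (- x)" using sub by (auto simp: A_def le_fun_def)
        then show "- p (- x) \<le> c x" using sublinear_minus_le[of c x] by simp
      qed
      then have le: "u x \<le> c x" if "c \<in> C" for c x
        unfolding u_def using that by (intro cINF_lower)
      have ge: "r \<le> u x" if "\<And>c. c \<in> C \<Longrightarrow> r \<le> c x" for r x
        unfolding u_def using that False by (intro cINF_greatest)
      have sl: "sublinear c" if "c \<in> C" for c using sub that by (auto simp: A_def)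
      have scale: "s * u x \<le> u (s *\<^sub>R x)" if "s > 0" for s x
        using that le by (intro ge) (simp add: sublinear_scale sl)
      have "sublinear u"
        unfolding sublinear_def
      proof (intro conjI allI impI)
        fix x y
        \<comment> \<open>The two summands may come from different members of the chain; the smaller
          one serves for both.\<close>
        have *: "u (x + y) \<le> c x + d y" if "c \<in> C" "d \<in> C" for c d
        proof (cases "c \<le> d")
          case True
          have "u (x + y) \<le> c x + c y"
            using le[OF \<open>c \<in> C\<close>, of "x + y"] sublinear_add[OF sl[OF \<open>c \<in> C\<close>], of x y] by simp
          then show ?thesis using True by (auto simp: le_fun_def intro: order_trans)
        next
          case False
          then have "d \<le> c" using chain that by blast
          have "u (x + y) \<le> d x + d y"
            using le[OF \<open>d \<in> C\<close>, of "x + y"] sublinear_add[OF sl[OF \<open>d \<in> C\<close>], of x y] by simp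
          then show ?thesis using \<open>d \<le> c\<close> by (auto simp: le_fun_def intro: order_trans)
        qed
        have "u (x + y) - c x \<le> u y" if "c \<in> C" for c
          using *[OF that] by (intro ge) (simp add: diff_le_eq add.commute)
        then have "u (x + y) - u y \<le> u x" by (intro ge) (simp add: diff_le_eq add.commute)
        then show "u (x + y) \<le> u x + u y" by simp
      next
        fix s :: real and x assume s: "s > 0"
        have "inverse s * u (s *\<^sub>R x) \<le> u x"
          using scale[of "inverse s" "s *\<^sub>R x"] s by simp
        then have "u (s *\<^sub>R x) \<le> s * u x" using s by (simp add: field_simps)
        with scale[OF s, of x] show "u (s *\<^sub>R x) = s * u x" by simp
      qed
      moreover have "u \<le> p"
      proof -
        obtain c where "c \<in> C" using False by blast
        then have "u \<le> c" "c \<le> p" using le sub by (auto simp: A_def intro: le_funI)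
        then show ?thesis by (rule order_trans)
      qed
      ultimately show ?thesis using le by (auto simp: A_def le_fun_def)
    qed
  qed
  then obtain q where q: "q \<in> A" "\<And>a. a \<in> A \<Longrightarrow> a \<le> q \<Longrightarrow> a = q" by blast
  show ?thesis
  proof (rule that)
    show "sublinear q" "q \<le> p" using q(1) by (auto simp: A_def)
    show "q' = q" if "sublinear q'" "q' \<le> q" for q'
      using that q(1) by (intro q(2)) (auto simp: A_def intro: order_trans)
  qed
qed

text \<open>Nothing is extended from a subspace: a minimal sublinear functional is itself linear. By
  minimality the directional infimum equals \<open>q\<close>, and its bound at \<open>- y\<close>
  makes \<open>q\<close> odd; oddness turns subadditivity at \<open>- x\<close>, \<open>- y\<close>
  into superadditivity.\<close>

theorem hahn_banach_sublinear:
  fixes p :: "'a::real_vector \<Rightarrow> real"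
  assumes "sublinear p"
  obtains l where "linear l" "\<And>x. l x \<le> p x"
proof -
  obtain q where q: "sublinear q" "q \<le> p"
    and min: "\<And>q'. sublinear q' \<Longrightarrow> q' \<le> q \<Longrightarrow> q' = q"
    using ex_minimal_sublinear[OF assms] by blast
  have minus: "q (- y) = - q y" for y
  proof (rule order_antisym)
    let ?q' = "\<lambda>x. INF t\<in>{0..}. q (x + t *\<^sub>R y) - t * q y"
    have eq: "?q' = q"
      using sublinear_directional_le(1,2)[OF q(1)] by (intro min le_funI)
    show "q (- y) \<le> - q y"
      using sublinear_directional_le(3)[OF q(1), of y] unfolding fun_cong[OF eq] .
    show "- q y \<le> q (- y)"
      using sublinear_minus_le[OF q(1), of "- y"] by simp
  qed
  have add: "q (x + y) = q x + q y" for x y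
  proof -
    have "- q (x + y) \<le> - q x + - q y"
      using sublinear_add[OF q(1), of "- x" "- y"] minus[of "x + y"] by (simp add: minus)
    then show ?thesis using sublinear_add[OF q(1), of x y] by simp
  qed
  have "linear q"
  proof (rule linearI)
    show "q (r *\<^sub>R x) = r *\<^sub>R q x" for r x
    proof -
      consider "r > 0" | "r = 0" | "- r > 0" by linarith
      then show ?thesis
      proof cases
        case 1
        then show ?thesis by (simp add: sublinear_scale[OF q(1)])
      next
        case 2
        then show ?thesis by (simp add: sublinear_zero[OF q(1)])
      next
        case 3
        have "- q (r *\<^sub>R x) = q ((- r) *\<^sub>R x)"
          by (simp only: scaleR_minus_left minus)
        also have "\<dots> = - r * q x" by (rule sublinear_scale[OF q(1) 3])
        finally show ?thesis by simp
      qed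
    qed
  qed (rule add)
  then show ?thesis using that[of q] le_funD[OF q(2)] by blast
qed

text \<open>A one-sided bound suffices because the ball is symmetric. The factor 2 in the constant
  comes from rescaling to norm \<open>r / 2\<close>, inside the open ball.\<close>

lemma bounded_linear_of_le_on_ball:
  fixes l :: "'a::real_normed_vector \<Rightarrow> real"
  assumes l: "linear l" and r: "r > 0" and le: "\<And>z. norm z < r \<Longrightarrow> l z \<le> M"
  shows "bounded_linear l"
proof (rule bounded_linear_intro[where K = "2 * M / r"])
  fix x
  have "l z * r \<le> 2 * M * norm z" if "z \<noteq> 0" for z
  proof -
    let ?s = "r / (2 * norm z)"
    have "norm (?s *\<^sub>R z) < r" using that r by simp
    from le[OF this] have "?s * l z \<le> M" by (simp add: linear_scale[OF l])
    then show ?thesis using that r by (simp add: field_simps)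
  qed
  from this[of x] this[of "- x"] show "norm (l x) \<le> norm x * (2 * M / r)"
    using r by (cases "x = 0") (auto simp: linear_0[OF l] linear_neg[OF l] field_simps abs_if)
qed (auto simp: linear_add[OF l] linear_scale[OF l])

text \<open>\<open>H\<close> plays the hypograph of a concave function but may be any convex set of
  pairs, so rays and functions with infinite values fit as well. Hahn-Banach is applied to
  differences \<open>x - y\<close>, for which \<open>f x - s\<close> is the natural bound; the
  constant \<open>c\<close> is then the supremum of \<open>s - l y\<close> over
  \<open>H\<close>.\<close>

theorem sandwich:
  fixes f :: "'a::real_normed_vector \<Rightarrow> real" and H :: "('a \<times> real) set"
  assumes f: "convex_on C f" and H: "convex H"
    and Hf: "\<And>x s. x \<in> C \<Longrightarrow> (x, s) \<in> H \<Longrightarrow> s \<le> f x"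
    and a: "(a, s0) \<in> H" and r: "r > 0"
    and bdd: "\<And>x. x \<in> ball a r \<Longrightarrow> x \<in> C \<and> f x \<le> M"
  obtains l :: "'a \<Rightarrow>\<^sub>L real" and c
  where "\<And>x. x \<in> C \<Longrightarrow> l x + c \<le> f x" "\<And>x s. (x, s) \<in> H \<Longrightarrow> s \<le> l x + c"
proof -
  \<comment> \<open>The values over \<open>z\<close> of the convex cone generated by all
    \<open>(x - y, f x - s)\<close>; its lower envelope \<open>Inf (S z)\<close> is
    sublinear.\<close>
  define S where "S z = {t * (f x - s) | t x y s. t > 0 \<and> x \<in> C \<and> (y, s) \<in> H \<and> z = t *\<^sub>R (x - y)}" for z
  have S_intro: "t * (f x - s) \<in> S (t *\<^sub>R (x - y))" if "t > 0" "x \<in> C" "(y, s) \<in> H" for t x y s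
    unfolding S_def using that by blast
  have S_ne: "S z \<noteq> {}" for z
  proof -
    \<comment> \<open>Small enough to keep \<open>a + s *\<^sub>R z\<close> in the ball around
      \<open>a\<close>, also for \<open>z = 0\<close>; scaling back by \<open>inverse s\<close>
      represents \<open>z\<close>.\<close>
    define s where "s = r / (norm z + r)"
    have "norm z + r > 0" using r norm_ge_zero[of z] by linarith
    then have "s > 0" "s * norm z < r"
      using r by (auto simp: s_def pos_divide_less_eq algebra_simps)
    then have "a + s *\<^sub>R z \<in> C" using bdd by (auto simp: dist_norm)
    from S_intro[OF _ this a, of "inverse s"] \<open>s > 0\<close> show ?thesis by auto
  qed
  have S_add: "\<exists>w\<in>S (z + z'). w \<le> u + u'" if "u \<in> S z" "u' \<in> S z'" for z z' u u'
  proof -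
    obtain t x y s where 1: "t > 0" "x \<in> C" "(y, s) \<in> H" "z = t *\<^sub>R (x - y)" "u = t * (f x - s)"
      using \<open>u \<in> S z\<close> by (auto simp: S_def)
    obtain t' x' y' s' where 2: "t' > 0" "x' \<in> C" "(y', s') \<in> H" "z' = t' *\<^sub>R (x' - y')"
        "u' = t' * (f x' - s')"
      using \<open>u' \<in> S z'\<close> by (auto simp: S_def)
    define T where "T = t + t'"
    have T: "T > 0" "t / T + t' / T = 1" "0 \<le> t / T" "0 \<le> t' / T"
      using 1 2 by (auto simp: T_def add_divide_distrib[symmetric])
    define x'' where "x'' = (t / T) *\<^sub>R x + (t' / T) *\<^sub>R x'"
    define y'' where "y'' = (t / T) *\<^sub>R y + (t' / T) *\<^sub>R y'"
    define s'' where "s'' = t / T * s + t' / T * s'"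
    have x'': "x'' \<in> C" "f x'' \<le> t / T * f x + t' / T * f x'"
      using f 1 2 T unfolding x''_def convex_on_def convex_def by blast+
    have y'': "(y'', s'') \<in> H"
      using convexD[OF H 1(3) 2(3) T(3,4,2)] by (simp add: y''_def s''_def)
    have "T * (f x'' - s'') \<le> T * ((t / T * f x + t' / T * f x') - s'')"
      using x''(2) T(1) by (intro mult_left_mono) auto
    also have "\<dots> = u + u'" using T(1) by (simp add: 1 2 s''_def field_simps)
    finally have "T * (f x'' - s'') \<le> u + u'" .
    moreover have "T *\<^sub>R (x'' - y'') = z + z'"
      using T(1) by (simp add: x''_def y''_def 1 2 algebra_simps)
    ultimately show ?thesis
      using S_intro[OF T(1) x''(1) y''] by auto
  qed
  have S_zero: "u \<ge> 0" if "u \<in> S 0" for u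
    using that Hf by (auto simp: S_def)
  have S_scale: "s * u \<in> S (s *\<^sub>R z)" if "s > 0" "u \<in> S z" for s u z
  proof -
    obtain t x y s' where "t > 0" "x \<in> C" "(y, s') \<in> H" "z = t *\<^sub>R (x - y)" "u = t * (f x - s')"
      using \<open>u \<in> S z\<close> by (auto simp: S_def)
    then show ?thesis using S_intro[of "s * t" x y s'] \<open>s > 0\<close> by (simp add: mult.assoc)
  qed
  \<comment> \<open>Adding a fixed element of \<open>S (- z)\<close> leads into \<open>S 0\<close>,
    where \<open>Hf\<close> forbids negative values.\<close>
  have "bdd_below (S z)" for z
  proof -
    obtain u0 where "u0 \<in> S (- z)" using S_ne by blast
    then have "- u0 \<le> u" if "u \<in> S z" for u
      using S_add[OF that \<open>u0 \<in> S (- z)\<close>] S_zero by fastforce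
    then show ?thesis by (rule bdd_belowI)
  qed
  then have p_le: "Inf (S z) \<le> u" if "u \<in> S z" for u z
    using that by (intro cInf_lower)
  have le_p: "c \<le> Inf (S z)" if "\<And>u. u \<in> S z \<Longrightarrow> c \<le> u" for c z
    using that S_ne by (intro cInf_greatest)
  have scale: "s * Inf (S z) \<le> Inf (S (s *\<^sub>R z))" if "s > 0" for s z
  proof (rule le_p)
    fix u assume "u \<in> S (s *\<^sub>R z)"
    then have "Inf (S z) \<le> inverse s * u"
      using S_scale[of "inverse s" u "s *\<^sub>R z"] that by (intro p_le) auto
    then show "s * Inf (S z) \<le> u" using that by (simp add: field_simps)
  qed
  have "sublinear (\<lambda>z. Inf (S z))"
    unfolding sublinear_def
  proof (intro conjI allI impI)
    fix z z'
    have *: "Inf (S (z + z')) \<le> u + u'" if "u \<in> S z" "u' \<in> S z'" for u u'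
      using S_add[OF that] p_le by (meson order_trans)
    have "Inf (S (z + z')) - u \<le> Inf (S z')" if "u \<in> S z" for u
      using *[OF that] by (intro le_p) (simp add: diff_le_eq add.commute)
    then have "Inf (S (z + z')) - Inf (S z') \<le> Inf (S z)"
      by (intro le_p) (simp add: diff_le_eq add.commute)
    then show "Inf (S (z + z')) \<le> Inf (S z) + Inf (S z')" by simp
  next
    fix s :: real and z assume s: "s > 0"
    have "inverse s * Inf (S (s *\<^sub>R z)) \<le> Inf (S z)"
      using scale[of "inverse s" "s *\<^sub>R z"] s by simp
    then have "Inf (S (s *\<^sub>R z)) \<le> s * Inf (S z)" using s by (simp add: field_simps)
    with scale[OF s, of z] show "Inf (S (s *\<^sub>R z)) = s * Inf (S z)" by simp
  qed
  then obtain l where l: "linear l" "\<And>z. l z \<le> Inf (S z)"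
    using hahn_banach_sublinear by blast
  have le: "s - l y \<le> f x - l x" if "x \<in> C" "(y, s) \<in> H" for x y s
    using l(2)[of "x - y"] p_le[OF S_intro[OF zero_less_one that]]
    by (simp add: linear_diff[OF l(1)])
  have "l z \<le> M - s0" if "norm z < r" for z
  proof -
    have "a + z \<in> C" "f (a + z) \<le> M" using bdd[of "a + z"] that by (auto simp: dist_norm)
    then show ?thesis using le[of "a + z" a] a by (fastforce simp: linear_add[OF l(1)])
  qed
  then have "bounded_linear l" using bounded_linear_of_le_on_ball[OF l(1) r] by blast
  then have L: "blinfun_apply (Blinfun l) = l" by (rule bounded_linear_Blinfun_apply)
  define c where "c = (SUP (y, s)\<in>H. s - l y)"
  have "a \<in> C" using bdd[of a] r by simp
  then have bd: "bdd_above ((\<lambda>(y, s). s - l y) ` H)"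
    using le by (intro bdd_aboveI2[where M = "f a - l a"]) auto
  have "s \<le> l y + c" if "(y, s) \<in> H" for y s
    using cSUP_upper[OF that bd] by (simp add: c_def)
  moreover have "l x + c \<le> f x" if "x \<in> C" for x
  proof -
    have "c \<le> f x - l x"
      unfolding c_def using that a le by (intro cSUP_least) auto
    then show ?thesis by simp
  qed
  ultimately show ?thesis using that[of "Blinfun l" c] by (simp add: L)
qed

section \<open>Convex functions and conjugates\<close>

lemma ereal_real_of_proper:
  "proper_fun f \<Longrightarrow> x \<in> edom f \<Longrightarrow> ereal (real_of_ereal (f x)) = f x"
  by (auto simp: proper_fun_def edom_def ereal_real)

lemma econvex_ereal_le:
  assumes "econvex f" "f x \<le> ereal r" "f y \<le> ereal s" "0 \<le> u" "0 \<le> v" "u + v = 1"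
  shows "f (u *\<^sub>R x + v *\<^sub>R y) \<le> ereal (u * r + v * s)"
proof -
  consider "u = 0" "v = 1" | "u = 1" "v = 0" | "0 < v" "v < 1" "u = 1 - v"
    using assms(4-6) by fastforce
  then show ?thesis
  proof cases
    case 3
    have "f (u *\<^sub>R x + v *\<^sub>R y) \<le> ereal u * f x + ereal v * f y"
      using assms(1) 3 by (auto simp: econvex_def)
    also have "\<dots> \<le> ereal u * ereal r + ereal v * ereal s"
      using assms(2-5) by (intro add_mono ereal_mult_left_mono) auto
    finally show ?thesis by simp
  qed (use assms in auto)
qed

lemma convex_edom:
  assumes "proper_fun f" "econvex f"
  shows "convex (edom f)"
proof (rule convexI)
  fix x y :: 'a and u v :: real
  assume "x \<in> edom f" "y \<in> edom f" "0 \<le> u" "0 \<le> v" "u + v = 1"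
  then have "f (u *\<^sub>R x + v *\<^sub>R y) \<le> ereal (u * real_of_ereal (f x) + v * real_of_ereal (f y))"
    using assms by (intro econvex_ereal_le) (auto simp: ereal_real_of_proper)
  then show "u *\<^sub>R x + v *\<^sub>R y \<in> edom f" by (auto simp: edom_def)
qed

lemma convex_on_real_of_econvex:
  assumes "proper_fun f" "econvex f"
  shows "convex_on (edom f) (\<lambda>x. real_of_ereal (f x))"
  unfolding convex_on_def
proof (intro conjI ballI allI impI)
  show "convex (edom f)" by (rule convex_edom[OF assms])
  fix x y :: 'a and u v :: real
  assume *: "x \<in> edom f" "y \<in> edom f" "0 \<le> u" "0 \<le> v" "u + v = 1"
  then have "f (u *\<^sub>R x + v *\<^sub>R y) \<le> ereal (u * real_of_ereal (f x) + v * real_of_ereal (f y))"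
    using assms by (intro econvex_ereal_le) (auto simp: ereal_real_of_proper)
  moreover have "u *\<^sub>R x + v *\<^sub>R y \<in> edom f"
    using convexD[OF convex_edom[OF assms]] * by blast
  ultimately show "real_of_ereal (f (u *\<^sub>R x + v *\<^sub>R y)) \<le> u * real_of_ereal (f x) + v * real_of_ereal (f y)"
    using ereal_real_of_proper[OF assms(1)] by (metis ereal_less_eq(3))
qed

text \<open>Puts \<open>f\<close> on the concave side of \<open>sandwich\<close>: the set is the
  hypograph of \<open>- f\<close>, with empty fibres where \<open>f\<close> is infinite.\<close>

lemma convex_hypograph_uminus:
  assumes "econvex f"
  shows "convex {(z, s). f z \<le> ereal (- s)}"
proof (rule convexI)
  fix p q :: "'a \<times> real" and u v :: real
  assume *: "p \<in> {(z, s). f z \<le> ereal (- s)}" "q \<in> {(z, s). f z \<le> ereal (- s)}"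
    "0 \<le> u" "0 \<le> v" "u + v = 1"
  obtain x s y t where "p = (x, s)" "q = (y, t)" by fastforce
  with * show "u *\<^sub>R p + v *\<^sub>R q \<in> {(z, s). f z \<le> ereal (- s)}"
    using econvex_ereal_le[OF assms, of x "- s" y "- t" u v] by simp
qed

lemma subdiff_iff:
  assumes "proper_fun f"
  shows "v \<in> subdiff f x \<longleftrightarrow> x \<in> edom f \<and>
    (\<forall>z\<in>edom f. real_of_ereal (f x) + v (z - x) \<le> real_of_ereal (f z))"
proof -
  have "f x + ereal (v (z - x)) \<le> f z \<longleftrightarrow>
      (z \<in> edom f \<longrightarrow> real_of_ereal (f x) + v (z - x) \<le> real_of_ereal (f z))"
    if "x \<in> edom f" for z
  proof (cases "z \<in> edom f")
    case True
    then show ?thesis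
      using ereal_real_of_proper[OF assms that] ereal_real_of_proper[OF assms True]
      by (metis ereal_less_eq(3) plus_ereal.simps(1))
  qed (simp add: edom_def)
  then show ?thesis by (auto simp: subdiff_def)
qed

lemma conjugate_le_iff:
  assumes "proper_fun f"
  shows "conjugate f v \<le> ereal c \<longleftrightarrow> (\<forall>z\<in>edom f. v z - real_of_ereal (f z) \<le> c)"
proof -
  have "ereal (v z) - f z \<le> ereal c \<longleftrightarrow> (z \<in> edom f \<longrightarrow> v z - real_of_ereal (f z) \<le> c)" for z
  proof (cases "z \<in> edom f")
    case True
    then show ?thesis
      using ereal_real_of_proper[OF assms True] by (metis ereal_less_eq(3) ereal_minus(1))
  qed (simp add: edom_def)
  then show ?thesis by (auto simp: conjugate_def SUP_le_iff)
qed

lemma fenchel_young: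
  fixes v :: "'a::real_normed_vector \<Rightarrow>\<^sub>L real"
  assumes "proper_fun f" "x \<in> edom f"
  shows "ereal (v x - real_of_ereal (f x)) \<le> conjugate f v"
proof -
  obtain r where "f x = ereal r" using ereal_real_of_proper[OF assms] by metis
  then show ?thesis unfolding conjugate_def by (intro SUP_upper2[of x]) auto
qed

lemma conjugate_ne_MInfty:
  assumes "proper_fun f"
  shows "conjugate f v \<noteq> -\<infinity>"
proof -
  obtain x where "x \<in> edom f" using assms by (auto simp: proper_fun_def)
  from fenchel_young[OF assms this, of v] show ?thesis by auto
qed

lemma proper_conjugateI:
  assumes "proper_fun f" "v \<in> edom (conjugate f)"
  shows "proper_fun (conjugate f)"
  using conjugate_ne_MInfty[OF assms(1)] assms(2) by (auto simp: proper_fun_def)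

text \<open>Equality in the Fenchel-Young inequality, written one-sidedly because the other
  direction always holds.\<close>

lemma subdiff_iff_conjugate:
  assumes "proper_fun f"
  shows "v \<in> subdiff f x \<longleftrightarrow>
    x \<in> edom f \<and> conjugate f v \<le> ereal (v x - real_of_ereal (f x))"
  by (auto simp: subdiff_iff conjugate_le_iff assms blinfun.diff_right algebra_simps)

lemma econvex_conjugate:
  assumes "proper_fun f"
  shows "econvex (conjugate f)"
  unfolding econvex_def
proof (intro allI impI)
  fix u v :: "'a \<Rightarrow>\<^sub>L real" and t :: real
  assume t: "0 < t" "t < 1"
  show "conjugate f ((1 - t) *\<^sub>R u + t *\<^sub>R v)
      \<le> ereal (1 - t) * conjugate f u + ereal t * conjugate f v"
    unfolding conjugate_def[of f "(1 - t) *\<^sub>R u + t *\<^sub>R v"]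
  proof (rule SUP_least)
    fix x
    show "ereal (((1 - t) *\<^sub>R u + t *\<^sub>R v) x) - f x
        \<le> ereal (1 - t) * conjugate f u + ereal t * conjugate f v"
    proof (cases "x \<in> edom f")
      case True
      define c where "c = real_of_ereal (f x)"
      have c: "f x = ereal c" using ereal_real_of_proper[OF assms True] by (simp add: c_def)
      have "ereal (((1 - t) *\<^sub>R u + t *\<^sub>R v) x) - f x
          = ereal (1 - t) * ereal (u x - c) + ereal t * ereal (v x - c)"
        by (simp add: c blinfun.add_left blinfun.diff_left blinfun.scaleR_left algebra_simps)
      also have "\<dots> \<le> ereal (1 - t) * conjugate f u + ereal t * conjugate f v"
        using t fenchel_young[OF assms True] unfolding c_def
        by (intro add_mono ereal_mult_left_mono) auto
      finally show ?thesis .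
    qed (simp add: edom_def)
  qed
qed

lemma lsc_conjugate:
  assumes "proper_fun f"
  shows "lsc (conjugate f)"
  unfolding lsc_def
proof
  fix c
  have "open {v :: 'a \<Rightarrow>\<^sub>L real. c < ereal (v x) - f x}" for x
  proof (cases "x \<in> edom f")
    case True
    then obtain r where "f x = ereal r" using ereal_real_of_proper[OF assms] by metis
    then have "{v :: 'a \<Rightarrow>\<^sub>L real. c < ereal (v x) - f x} = (\<lambda>v :: 'a \<Rightarrow>\<^sub>L real. ereal (v x - r)) -` {c<..}"
      by auto
    moreover have "open \<dots>"
      by (intro open_vimage open_greaterThan continuous_on_ereal continuous_intros)
    ultimately show ?thesis by simp
  qed (simp add: edom_def)
  moreover have "{v. c < conjugate f v} = (\<Union>x. {v :: 'a \<Rightarrow>\<^sub>L real. c < ereal (v x) - f x})"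
    by (auto simp: conjugate_def less_SUP_iff)
  ultimately show "open {v. c < conjugate f v}" by auto
qed

section \<open>Upper bounds near interior points of the domain\<close>

definition bounded_above_near :: "('a::metric_space \<Rightarrow> ereal) \<Rightarrow> 'a \<Rightarrow> bool" where
  "bounded_above_near f a \<longleftrightarrow> (\<exists>r>0. \<exists>M::real. \<forall>x\<in>ball a r. f x \<le> ereal M)"

lemma bounded_above_nearE:
  assumes "bounded_above_near f a" "proper_fun f"
  obtains r M where "r > 0" "\<And>x. x \<in> ball a r \<Longrightarrow> x \<in> edom f \<and> real_of_ereal (f x) \<le> M"
proof -
  obtain r M where "r > 0" and M: "\<And>x. x \<in> ball a r \<Longrightarrow> f x \<le> ereal M"
    using assms(1) unfolding bounded_above_near_def by blast
  have "x \<in> edom f \<and> real_of_ereal (f x) \<le> M" if "x \<in> ball a r" for x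
  proof -
    have "x \<in> edom f" using M[OF that] by (auto simp: edom_def)
    then show ?thesis using M[OF that] ereal_real_of_proper[OF assms(2)] by (metis ereal_less_eq(3))
  qed
  then show ?thesis using that \<open>r > 0\<close> by blast
qed

lemma completely_metrizable_Union_closed:
  fixes F :: "nat \<Rightarrow> 'a::complete_space set"
  assumes "\<And>n. closed (F n)" "open U" "U \<noteq> {}" "U \<subseteq> (\<Union>n. F n)"
  obtains n where "interior (F n) \<noteq> {}"
proof (rule ccontr)
  assume "\<not> thesis"
  then have "interior (F n) = {}" for n using that by blast
  then have "euclidean interior_of (\<Union>(range F)) = {}"
    using assms(1) by (intro Baire_category_alt) (auto simp: completely_metrizable_space_euclidean)
  moreover have "U \<subseteq> interior (\<Union>(range F))" using assms by (intro interior_maximal) auto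
  ultimately show False using assms(3) by simp
qed

text \<open>The segment from \<open>b\<close> to \<open>a\<close> is prolonged beyond
  \<open>a\<close>; the weights recover \<open>a\<close> as a point strictly between the new
  endpoint and \<open>b\<close>.\<close>

lemma convex_combination_of_extension:
  fixes a b :: "'a::real_vector"
  assumes "e > 0"
  defines "u \<equiv> 1 / (1 + e)" and "v \<equiv> e / (1 + e)"
  shows "0 < u" "0 < v" "u + v = 1" "u *\<^sub>R (a + e *\<^sub>R (a - b)) + v *\<^sub>R b = a"
proof -
  show "0 < u" "0 < v" "u + v = 1"
    using assms by (auto simp: add_divide_distrib[symmetric])
  have "u * e = v" using assms by simp
  then have "u *\<^sub>R (a + e *\<^sub>R (a - b)) + v *\<^sub>R b = (u + v) *\<^sub>R a"
    by (simp add: algebra_simps)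
  then show "u *\<^sub>R (a + e *\<^sub>R (a - b)) + v *\<^sub>R b = a" using \<open>u + v = 1\<close> by simp
qed

text \<open>The map sending \<open>b'\<close> to \<open>u *\<^sub>R y + v *\<^sub>R b'\<close> takes
  \<open>b\<close> to \<open>a\<close> and scales distances by \<open>v\<close>, so it carries
  information from a ball at \<open>b\<close> to a smaller ball at \<open>a\<close>.\<close>

lemma ball_shrink_towards:
  fixes a b y :: "'a::real_normed_vector"
  assumes "0 < v" "u *\<^sub>R y + v *\<^sub>R b = a" "x \<in> ball a (v * s)"
  obtains b' where "b' \<in> ball b s" "x = u *\<^sub>R y + v *\<^sub>R b'"
proof
  show "x = u *\<^sub>R y + v *\<^sub>R (b + (1 / v) *\<^sub>R (x - a))"
    using assms(1) by (simp add: scaleR_add_right flip: assms(2))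
  have "norm (x - a) / v < s"
    using assms(1,3) by (simp add: dist_norm norm_minus_commute field_simps)
  then show "b + (1 / v) *\<^sub>R (x - a) \<in> ball b s"
    using assms(1) by (simp add: dist_norm del: scaleR_right_diff_distrib scaleR_diff_right)
qed

text \<open>The closed sublevel sets cover the interior of the domain, so by Baire one of them
  contains a ball, but around some unknown \<open>b\<close>. Convexity moves the bound to
  \<open>a\<close>, using the finite value at a point \<open>y\<close> on the far side of
  \<open>a\<close>.\<close>

lemma bounded_above_near_interior:
  fixes f :: "'a::banach \<Rightarrow> ereal"
  assumes f: "proper_fun f" "econvex f" "lsc f" and a: "a \<in> interior (edom f)"
  shows "bounded_above_near f a"
proof -
  have "closed {x. f x \<le> ereal (real n)}" for n
  proof -
    have "{x. f x \<le> ereal (real n)} = - {x. ereal (real n) < f x}" by auto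
    then show ?thesis using f(3) by (simp add: lsc_def closed_Compl)
  qed
  moreover have "interior (edom f) \<subseteq> (\<Union>n. {x. f x \<le> ereal (real n)})"
  proof
    fix x assume "x \<in> interior (edom f)"
    then obtain r where r: "f x = ereal r"
      using ereal_real_of_proper[OF f(1)] interior_subset by (metis subset_iff)
    obtain n where "r \<le> real n" using real_arch_simple by blast
    then show "x \<in> (\<Union>n. {x. f x \<le> ereal (real n)})" using r by auto
  qed
  ultimately obtain n where "interior {x. f x \<le> ereal (real n)} \<noteq> {}"
    using a completely_metrizable_Union_closed[of "\<lambda>n. {x. f x \<le> ereal (real n)}" "interior (edom f)"]
    by blast
  then obtain b s where s: "s > 0" "ball b s \<subseteq> {x. f x \<le> ereal (real n)}"
    by (meson all_not_in_conv mem_interior)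
  obtain r where r: "r > 0" "ball a r \<subseteq> edom f" using a by (meson mem_interior)
  \<comment> \<open>Keeps \<open>y\<close> within distance \<open>r\<close> of \<open>a\<close>; the
    summand \<open>r\<close> makes the denominator positive even if \<open>a = b\<close>.\<close>
  define e where "e = r / (norm (a - b) + r)"
  have "norm (a - b) + r > 0" using r norm_ge_zero[of "a - b"] by linarith
  then have e: "e > 0" "e * norm (a - b) < r"
    using r by (auto simp: e_def pos_divide_less_eq algebra_simps)
  define y where "y = a + e *\<^sub>R (a - b)"
  have "y \<in> edom f" using e r(2) by (auto simp: y_def dist_norm)
  then obtain c where c: "f y = ereal c" using ereal_real_of_proper[OF f(1)] by metis
  define u v where "u = 1 / (1 + e)" and "v = e / (1 + e)"
  note uv = convex_combination_of_extension(1-3)[OF e(1), folded u_def v_def]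
    convex_combination_of_extension(4)[OF e(1), of a b, folded u_def v_def y_def]
  have "f x \<le> ereal (u * c + v * real n)" if x: "x \<in> ball a (v * s)" for x
  proof -
    obtain b' where "b' \<in> ball b s" "x = u *\<^sub>R y + v *\<^sub>R b'"
      using ball_shrink_towards[OF uv(2,4) x] .
    then show ?thesis
      using s uv c by (auto intro!: econvex_ereal_le[OF f(2)])
  qed
  moreover have "v * s > 0" using uv s by simp
  ultimately show ?thesis unfolding bounded_above_near_def by blast
qed

section \<open>Rays and support functionals\<close>

lemma convex_ray:
  fixes a h :: "'a::real_normed_vector"
  shows "convex ((\<lambda>s. (a + s *\<^sub>R h, b + s * k)) ` {0::real..})"
proof -
  have "(\<lambda>s. (a + s *\<^sub>R h, b + s * k)) ` {0..} = (+) (a, b) ` (\<lambda>s. s *\<^sub>R (h, k)) ` {0..}"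
    by (simp add: image_image)
  moreover have "linear (\<lambda>s. s *\<^sub>R (h, k))"
    by (rule bounded_linear.linear[OF bounded_linear_scaleR_left])
  ultimately show ?thesis
    by (simp only:) (intro convex_translation convex_linear_image convex_real_interval)
qed

text \<open>The zero function on \<open>C\<close> is separated from a ray that starts at
  \<open>a\<close> with height -1, reaches height 0 over \<open>x\<close> and keeps rising. Beyond
  \<open>x\<close> the ray is outside \<open>C\<close>, for otherwise \<open>x\<close> would be
  interior. Contact at \<open>x\<close> gives the supporting inequality, and the positive height at
  parameter 2 excludes \<open>l = 0\<close>.\<close>

lemma support_functional:
  fixes C :: "'a::real_normed_vector set"
  assumes C: "convex C" and a: "a \<in> interior C" and x: "x \<in> C" "x \<notin> interior C"
  obtains l :: "'a \<Rightarrow>\<^sub>L real" where "l \<noteq> 0" "\<And>z. z \<in> C \<Longrightarrow> l (z - x) \<le> 0"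
proof -
  obtain r where r: "r > 0" "ball a r \<subseteq> C" using a by (meson mem_interior)
  define H where "H = (\<lambda>s. (a + s *\<^sub>R (x - a), -1 + s * 1)) ` {0::real..}"
  have "convex H" unfolding H_def by (rule convex_ray)
  moreover have "s \<le> 1" if "a + s *\<^sub>R (x - a) \<in> C" for s
  proof (rule ccontr)
    assume "\<not> s \<le> 1"
    then have s: "s > 1" by simp
    let ?y = "a + s *\<^sub>R (x - a)"
    have eq: "(1 / s) *\<^sub>R ?y + (1 - 1 / s) *\<^sub>R a = x" using s by (simp add: algebra_simps)
    have "ball x ((1 - 1 / s) * r) \<subseteq> C"
    proof
      fix z assume "z \<in> ball x ((1 - 1 / s) * r)"
      then obtain b where "b \<in> ball a r" "z = (1 / s) *\<^sub>R ?y + (1 - 1 / s) *\<^sub>R b"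
        using ball_shrink_towards[OF _ eq] s by auto
      then show "z \<in> C" using r(2) s that by (auto intro!: convexD[OF C])
    qed
    then show False using x(2) s r(1) by (auto simp: mem_interior)
  qed
  ultimately obtain l :: "'a \<Rightarrow>\<^sub>L real" and c where l: "\<And>z. z \<in> C \<Longrightarrow> l z + c \<le> 0"
    and H: "\<And>z s. (z, s) \<in> H \<Longrightarrow> s \<le> l z + c"
    using r by (elim sandwich[of C "\<lambda>_. 0" H a "-1" r 0, rotated -1])
      (force simp: H_def C convex_on_const)+
  have H': "s - 1 \<le> l a + s * l (x - a) + c" if "s \<ge> 0" for s
    using H[of "a + s *\<^sub>R (x - a)" "s - 1"] that
    by (fastforce simp: H_def blinfun.add_right blinfun.scaleR_right)
  have "l x + c = 0"
    using H'[of 1] l[OF x(1)] by (simp add: blinfun.diff_right)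
  then have "l (z - x) \<le> 0" if "z \<in> C" for z
    using l[OF that] by (simp add: blinfun.diff_right)
  moreover have "l \<noteq> 0"
  proof
    assume "l = 0"
    then show False using H'[of 2] \<open>l x + c = 0\<close> by simp
  qed
  ultimately show ?thesis using that by blast
qed

section \<open>Biconjugation\<close>

lemma lsc_nearE:
  fixes f :: "'a::metric_space \<Rightarrow> ereal"
  assumes "lsc f" "c < f x"
  obtains d where "d > 0" "\<And>z. dist z x < d \<Longrightarrow> c < f z"
proof -
  have "open {z. c < f z}" "x \<in> {z. c < f z}" using assms by (auto simp: lsc_def)
  then show ?thesis using that unfolding open_dist by blast
qed

text \<open>Lower semicontinuity at one point \<open>a\<close> of the domain bounds \<open>f\<close>
  below near \<open>a\<close>; convexity along segments from \<open>a\<close> then limits how fast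
  \<open>f\<close> can decrease farther away.\<close>

lemma lsc_lower_bound:
  fixes f :: "'a::real_normed_vector \<Rightarrow> ereal"
  assumes f: "proper_fun f" "econvex f" "lsc f"
  obtains c K where "K \<ge> 0" "\<And>z. z \<in> edom f \<Longrightarrow> c - K * norm (z - x) \<le> real_of_ereal (f z)"
proof -
  obtain a where a: "a \<in> edom f" using f(1) by (auto simp: proper_fun_def)
  define c where "c = real_of_ereal (f a)"
  have c: "f a = ereal c" using ereal_real_of_proper[OF f(1) a] by (simp add: c_def)
  have "ereal (c - 1) < f a" using c by simp
  then obtain d where d: "d > 0" "\<And>z. dist z a < d \<Longrightarrow> ereal (c - 1) < f z"
    using lsc_nearE[OF f(3)] by blast
  have bound: "c - 1 - (2 / d) * norm (z - a) \<le> real_of_ereal (f z)" if z: "z \<in> edom f" for z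
  proof -
    obtain t where t: "f z = ereal t" using ereal_real_of_proper[OF f(1) z] by metis
    show ?thesis
    proof (cases "norm (z - a) < d")
      case True
      then have "c - 1 < t" using d(2)[of z] t by (simp add: dist_norm)
      moreover have "0 \<le> (2 / d) * norm (z - a)" using d(1) by simp
      ultimately show ?thesis using t by simp
    next
      case False
      then have pos: "norm (z - a) > 0" using d(1) by linarith
      \<comment> \<open>Places the point of the segment at distance \<open>d / 2\<close> from
        \<open>a\<close>, where the local bound holds.\<close>
      define s where "s = d / (2 * norm (z - a))"
      have s: "0 < s" "s < 1" using False d(1) pos by (auto simp: s_def field_simps)
      have "dist ((1 - s) *\<^sub>R a + s *\<^sub>R z) a = norm (s *\<^sub>R (z - a))"
        by (simp add: dist_norm algebra_simps)
      also have "\<dots> < d" using d(1) pos s by (simp add: s_def)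
      finally have "ereal (c - 1) < f ((1 - s) *\<^sub>R a + s *\<^sub>R z)" by (rule d(2))
      also have "\<dots> \<le> ereal ((1 - s) * c + s * t)"
        using c t s by (intro econvex_ereal_le[OF f(2)]) auto
      finally have "c - 1 / s \<le> t" using s by (simp add: field_simps)
      moreover have "1 / s = (2 / d) * norm (z - a)" using pos d(1) by (simp add: s_def)
      ultimately show ?thesis using t by simp
    qed
  qed
  show ?thesis
  proof (rule that)
    show "2 / d \<ge> 0" using d(1) by simp
    fix z assume "z \<in> edom f"
    have "(2 / d) * norm (z - a) \<le> (2 / d) * (norm (z - x) + norm (x - a))"
      using d(1) norm_triangle_ineq[of "z - x" "x - a"] by (intro mult_left_mono) auto
    with bound[OF \<open>z \<in> edom f\<close>]
    show "(c - 1 - (2 / d) * norm (x - a)) - (2 / d) * norm (z - x) \<le> real_of_ereal (f z)"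
      by (simp add: algebra_simps)
  qed
qed

text \<open>The hypograph of \<open>- f\<close> is separated from a cone with vertex at height
  \<open>- c\<close> over \<open>x\<close>. The cone is finite everywhere and locally bounded, so
  \<open>x\<close> may lie outside the domain of \<open>f\<close>. The functional sought is
  \<open>- l\<close>.\<close>

theorem fenchel_moreau:
  fixes f :: "'a::real_normed_vector \<Rightarrow> ereal"
  assumes f: "proper_fun f" "econvex f" "lsc f" and c: "ereal c < f x"
  obtains v where "conjugate f v \<le> ereal (v x - c)"
proof -
  obtain b K where K: "K \<ge> 0" "\<And>z. z \<in> edom f \<Longrightarrow> b - K * norm (z - x) \<le> real_of_ereal (f z)"
    using lsc_lower_bound[OF f] by blast
  obtain d where d: "d > 0" "\<And>z. dist z x < d \<Longrightarrow> ereal c < f z"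
    using lsc_nearE[OF f(3) c] by blast
  \<comment> \<open>Within distance \<open>d\<close> of \<open>x\<close> lower semicontinuity
    suffices; farther out the additional slope absorbs the offset \<open>c - b\<close>.\<close>
  define L where "L = K + \<bar>c - b\<bar> / d"
  have L: "c - L * norm (z - x) \<le> real_of_ereal (f z)" if z: "z \<in> edom f" for z
  proof (cases "norm (z - x) < d")
    case True
    have "ereal c < ereal (real_of_ereal (f z))"
      using d(2)[of z] True by (simp add: dist_norm ereal_real_of_proper[OF f(1) z])
    moreover have "0 \<le> L * norm (z - x)" using K(1) d(1) by (simp add: L_def)
    ultimately show ?thesis by simp
  next
    case False
    then have "\<bar>c - b\<bar> * d \<le> \<bar>c - b\<bar> * norm (z - x)" by (intro mult_left_mono) auto
    then have "\<bar>c - b\<bar> \<le> \<bar>c - b\<bar> / d * norm (z - x)" using d(1) by (simp add: field_simps)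
    then show ?thesis using K(2)[OF z] by (simp add: L_def algebra_simps)
  qed
  obtain a where "a \<in> edom f" using f(1) by (auto simp: proper_fun_def)
  then have a: "(a, - real_of_ereal (f a)) \<in> {(z, s). f z \<le> ereal (- s)}"
    using ereal_real_of_proper[OF f(1)] by simp
  have "convex_on UNIV (\<lambda>z. L * norm (z - x) - c)"
  proof -
    have "convex_on UNIV (\<lambda>z. L * norm (z - x) + (- c))"
      using K(1) d(1) convex_on_dist[of UNIV x]
      by (intro convex_on_add convex_on_cmul) (auto simp: L_def dist_norm norm_minus_commute convex_on_const)
    then show ?thesis by simp
  qed
  moreover have "s \<le> L * norm (z - x) - c" if "f z \<le> ereal (- s)" for z s
  proof -
    have "z \<in> edom f" using that by (auto simp: edom_def)
    moreover have "real_of_ereal (f z) \<le> - s"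
      using that ereal_real_of_proper[OF f(1) \<open>z \<in> edom f\<close>] by (metis ereal_less_eq(3))
    ultimately show ?thesis using L[of z] by linarith
  qed
  moreover have "L * norm (z - x) - c \<le> L * (1 + norm (a - x)) - c" if "z \<in> ball a 1" for z
  proof -
    have "norm (z - x) \<le> 1 + norm (a - x)"
      using that norm_triangle_ineq[of "z - a" "a - x"] by (simp add: dist_norm norm_minus_commute)
    then show ?thesis using K(1) d(1) by (simp add: L_def mult_left_mono)
  qed
  ultimately obtain l :: "'a \<Rightarrow>\<^sub>L real" and k where l: "\<And>z. z \<in> UNIV \<Longrightarrow> l z + k \<le> L * norm (z - x) - c"
    and f_le: "\<And>z s. (z, s) \<in> {(z, s). f z \<le> ereal (- s)} \<Longrightarrow> s \<le> l z + k"
    using sandwich[OF _ convex_hypograph_uminus[OF f(2)] _ a zero_less_one, of UNIV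
        "\<lambda>z. L * norm (z - x) - c" "L * (1 + norm (a - x)) - c"]
    by blast
  have "- l z - real_of_ereal (f z) \<le> - l x - c" if "z \<in> edom f" for z
    using f_le[of z "- real_of_ereal (f z)"] ereal_real_of_proper[OF f(1) that] l[of x] by simp
  then show ?thesis
    by (intro that[of "- l"]) (auto simp: conjugate_le_iff[OF f(1)] blinfun.minus_left)
qed

section \<open>Subgradients and Gateaux derivatives\<close>

lemma subdiff_gateaux_eq:
  assumes f: "proper_fun f" and v: "v \<in> gateaux f x" and u: "u \<in> subdiff f x"
  shows "u = v"
proof -
  let ?q = "\<lambda>h t. (real_of_ereal (f (x + t *\<^sub>R h)) - real_of_ereal (f x)) / t"
  have x: "x \<in> interior (edom f)" using v by (simp add: gateaux_def)
  have le: "u h \<le> v h" for h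
  proof (rule tendsto_lowerbound)
    have "(?q h \<longlongrightarrow> v h) (at 0)" using v by (simp add: gateaux_def)
    then show "(?q h \<longlongrightarrow> v h) (at_right 0)" by (rule tendsto_mono[rotated]) (simp add: at_le)
    have "((\<lambda>t. x + t *\<^sub>R h) \<longlongrightarrow> x + 0 *\<^sub>R h) (at_right 0)" by (intro tendsto_intros)
    then have "eventually (\<lambda>t. x + t *\<^sub>R h \<in> interior (edom f)) (at_right 0)"
      using x by (auto elim: topological_tendstoD)
    then show "eventually (\<lambda>t. u h \<le> ?q h t) (at_right 0)"
      using eventually_at_right_less[of "0 :: real"]
    proof eventually_elim
      case (elim t)
      then have "real_of_ereal (f x) + u ((x + t *\<^sub>R h) - x) \<le> real_of_ereal (f (x + t *\<^sub>R h))"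
        using u interior_subset subdiff_iff[OF f] by blast
      then show ?case using elim by (simp add: field_simps blinfun.scaleR_right)
    qed
  qed simp
  have "u h = v h" for h
    using le[of h] le[of "- h"] by (simp add: blinfun.minus_right)
  then show ?thesis by (rule blinfun_eqI)
qed

lemma gateaux_subset_subdiff:
  assumes f: "proper_fun f" "econvex f"
  shows "gateaux f x \<subseteq> subdiff f x"
proof
  fix v assume v: "v \<in> gateaux f x"
  let ?q = "\<lambda>h t. (real_of_ereal (f (x + t *\<^sub>R h)) - real_of_ereal (f x)) / t"
  have x: "x \<in> edom f" using v interior_subset by (auto simp: gateaux_def)
  note cvx = convex_on_real_of_econvex[OF f]
  have "real_of_ereal (f x) + v (z - x) \<le> real_of_ereal (f z)" if z: "z \<in> edom f" for z
  proof -
    have "v (z - x) \<le> real_of_ereal (f z) - real_of_ereal (f x)"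
    proof (rule tendsto_upperbound)
      have "(?q (z - x) \<longlongrightarrow> v (z - x)) (at 0)" using v by (simp add: gateaux_def)
      then show "(?q (z - x) \<longlongrightarrow> v (z - x)) (at_right 0)"
        by (rule tendsto_mono[rotated]) (simp add: at_le)
      have "eventually (\<lambda>t::real. t < 1) (at_right 0)"
        by (intro eventually_at_right_real[of 0 1, THEN eventually_mono]) auto
      then show "eventually (\<lambda>t. ?q (z - x) t \<le> real_of_ereal (f z) - real_of_ereal (f x)) (at_right 0)"
        using eventually_at_right_less[of "0 :: real"]
      proof eventually_elim
        case (elim t)
        have "x + t *\<^sub>R (z - x) = (1 - t) *\<^sub>R x + t *\<^sub>R z" by (simp add: algebra_simps)
        then have "real_of_ereal (f (x + t *\<^sub>R (z - x))) \<le> (1 - t) * real_of_ereal (f x) + t * real_of_ereal (f z)"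
          using convex_onD[OF cvx, of t x z] x z elim by simp
        then show ?case using elim by (simp add: field_simps)
      qed
    qed simp
    then show ?thesis by simp
  qed
  then show "v \<in> subdiff f x" by (simp add: subdiff_iff[OF f(1)] x)
qed

text \<open>The nontrivial half of the max formula: a lower bound for the slope along
  \<open>h\<close> is realised by a subgradient. The ray prescribes value and slope in
  \<open>sandwich\<close>. With \<open>h = 0\<close> this is plain existence of
  subgradients.\<close>

lemma ex_subgradient_ge_on_ray:
  fixes f :: "'a::real_normed_vector \<Rightarrow> ereal"
  assumes f: "proper_fun f" "econvex f" and bdd: "bounded_above_near f a"
    and k: "\<And>t. t \<ge> 0 \<Longrightarrow> a + t *\<^sub>R h \<in> edom f \<Longrightarrow>
      real_of_ereal (f a) + t * k \<le> real_of_ereal (f (a + t *\<^sub>R h))"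
  obtains v where "v \<in> subdiff f a" "k \<le> v h"
proof -
  obtain r M where r: "r > 0" "\<And>x. x \<in> ball a r \<Longrightarrow> x \<in> edom f \<and> real_of_ereal (f x) \<le> M"
    using bounded_above_nearE[OF bdd f(1)] by blast
  define H where "H = (\<lambda>t. (a + t *\<^sub>R h, real_of_ereal (f a) + t * k)) ` {0::real..}"
  have H: "(a + t *\<^sub>R h, real_of_ereal (f a) + t * k) \<in> H" if "t \<ge> 0" for t
    using that by (auto simp: H_def)
  obtain v :: "'a \<Rightarrow>\<^sub>L real" and c where v: "\<And>x. x \<in> edom f \<Longrightarrow> v x + c \<le> real_of_ereal (f x)"
    and H_le: "\<And>x s. (x, s) \<in> H \<Longrightarrow> s \<le> v x + c"
  proof (rule sandwich[OF convex_on_real_of_econvex[OF f], of H])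
    show "convex H" unfolding H_def by (rule convex_ray)
    show "s \<le> real_of_ereal (f x)" if "x \<in> edom f" "(x, s) \<in> H" for x s
      using that k by (auto simp: H_def)
    show "(a, real_of_ereal (f a)) \<in> H" using H[of 0] by simp
  qed (use r in blast)+
  have a: "a \<in> edom f" using r by auto
  have 0: "real_of_ereal (f a) = v a + c" using H_le[OF H[of 0]] v[OF a] by simp
  then have "v \<in> subdiff f a" using v by (simp add: subdiff_iff[OF f(1)] a blinfun.diff_right add.commute)
  moreover have "k \<le> v h" using H_le[OF H[of 1]] 0 by (simp add: blinfun.add_right)
  ultimately show ?thesis using that by blast
qed

lemma subdiff_nonempty:
  fixes f :: "'a::real_normed_vector \<Rightarrow> ereal"
  assumes "proper_fun f" "econvex f" "bounded_above_near f a"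
  shows "subdiff f a \<noteq> {}"
  using ex_subgradient_ge_on_ray[OF assms, of 0 0] by auto

text \<open>If all quotients along \<open>h\<close> were at least \<open>v h + e\<close>, the ray
  lemma would yield a second subgradient. So some quotient is smaller, and by convexity so are all
  those with shorter positive steps. Negative steps are positive steps along
  \<open>- h\<close>.\<close>

lemma unique_subgradient_imp_gateaux:
  fixes f :: "'a::real_normed_vector \<Rightarrow> ereal"
  assumes f: "proper_fun f" "econvex f" and bdd: "bounded_above_near f a"
    and unique: "subdiff f a = {v}"
  shows "v \<in> gateaux f a"
proof -
  let ?F = "\<lambda>x. real_of_ereal (f x)"
  obtain r M where r: "r > 0" "\<And>x. x \<in> ball a r \<Longrightarrow> x \<in> edom f \<and> ?F x \<le> M"
    using bounded_above_nearE[OF bdd f(1)] by blast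
  have a: "a \<in> interior (edom f)" using r by (meson mem_interior subsetI)
  note cvx = convex_on_real_of_econvex[OF f]
  have v: "?F a + v (z - a) \<le> ?F z" if "z \<in> edom f" for z
    using unique subdiff_iff[OF f(1), of v a] that by auto
  have upper: "\<exists>d>0. \<forall>t. 0 < t \<and> t < d \<longrightarrow>
      v h \<le> (?F (a + t *\<^sub>R h) - ?F a) / t \<and> (?F (a + t *\<^sub>R h) - ?F a) / t < v h + e"
    if "e > 0" for h e
  proof -
    have "\<exists>s\<ge>0. a + s *\<^sub>R h \<in> edom f \<and> ?F (a + s *\<^sub>R h) < ?F a + s * (v h + e)"
    proof (rule ccontr)
      assume "\<not> ?thesis"
      then obtain u where "u \<in> subdiff f a" "v h + e \<le> u h"
        using ex_subgradient_ge_on_ray[OF f bdd, of h "v h + e"] by force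
      then show False using unique \<open>e > 0\<close> by simp
    qed
    then obtain s where s: "s \<ge> 0" "a + s *\<^sub>R h \<in> edom f" "?F (a + s *\<^sub>R h) < ?F a + s * (v h + e)"
      by blast
    then have "s > 0" by (cases "s = 0") auto
    have "v h \<le> (?F (a + t *\<^sub>R h) - ?F a) / t \<and> (?F (a + t *\<^sub>R h) - ?F a) / t < v h + e"
      if "0 < t" "t < s" for t
    proof -
      have eq: "a + t *\<^sub>R h = (1 - t / s) *\<^sub>R a + (t / s) *\<^sub>R (a + s *\<^sub>R h)"
        using \<open>s > 0\<close> by (simp add: algebra_simps)
      have a': "a \<in> edom f" using a interior_subset by blast
      have "?F (a + t *\<^sub>R h) \<le> (1 - t / s) * ?F a + (t / s) * ?F (a + s *\<^sub>R h)"
        unfolding eq using that \<open>s > 0\<close> s(2) a' by (intro convex_onD[OF cvx]) auto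
      also have "\<dots> < (1 - t / s) * ?F a + (t / s) * (?F a + s * (v h + e))"
        using s(3) that \<open>s > 0\<close> by (intro add_strict_left_mono mult_strict_left_mono) auto
      also have "\<dots> = ?F a + t * (v h + e)" using \<open>s > 0\<close> by (simp add: field_simps)
      finally have "?F (a + t *\<^sub>R h) < ?F a + t * (v h + e)" .
      moreover have "a + t *\<^sub>R h \<in> edom f"
        unfolding eq using that \<open>s > 0\<close> s(2) a' by (intro convexD[OF convex_edom[OF f]]) auto
      then have "?F a + t * v h \<le> ?F (a + t *\<^sub>R h)"
        using v[of "a + t *\<^sub>R h"] by (simp add: blinfun.scaleR_right)
      ultimately show ?thesis using that by (simp add: field_simps)
    qed
    then show ?thesis using \<open>s > 0\<close> by blast
  qed
  have "((\<lambda>t. (?F (a + t *\<^sub>R h) - ?F a) / t) \<longlongrightarrow> v h) (at 0)" for h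
  proof (rule LIM_I)
    fix e :: real assume "e > 0"
    obtain d where d: "d > 0" "\<And>t. 0 < t \<Longrightarrow> t < d \<Longrightarrow>
        v h \<le> (?F (a + t *\<^sub>R h) - ?F a) / t \<and> (?F (a + t *\<^sub>R h) - ?F a) / t < v h + e"
      using upper[OF \<open>e > 0\<close>, of h] by blast
    obtain d' where d': "d' > 0" "\<And>t. 0 < t \<Longrightarrow> t < d' \<Longrightarrow>
        v (- h) \<le> (?F (a + t *\<^sub>R (- h)) - ?F a) / t \<and> (?F (a + t *\<^sub>R (- h)) - ?F a) / t < v (- h) + e"
      using upper[OF \<open>e > 0\<close>, of "- h"] by blast
    have "norm ((?F (a + t *\<^sub>R h) - ?F a) / t - v h) < e"
      if "t \<noteq> 0" "norm (t - 0) < min d d'" for t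
    proof (cases "t > 0")
      case True
      then show ?thesis using d(2)[of t] that by (simp add: abs_if)
    next
      case False
      then have "- t > 0" "- t < d'" using that by auto
      from d'(2)[OF this] show ?thesis by (simp add: blinfun.minus_right)
    qed
    then show "\<exists>s>0. \<forall>t. t \<noteq> 0 \<and> norm (t - 0) < s \<longrightarrow> norm ((?F (a + t *\<^sub>R h) - ?F a) / t - v h) < e"
      using d(1) d'(1) by (intro exI[of _ "min d d'"]) auto
  qed
  then show ?thesis using a by (simp add: gateaux_def)
qed

section \<open>Subdifferentials in reflexive spaces\<close>

lemma reflexive_spaceE:
  fixes \<xi> :: "('a::real_normed_vector \<Rightarrow>\<^sub>L real) \<Rightarrow>\<^sub>L real"
  assumes "reflexive_space TYPE('a)"
  obtains x :: 'a where "\<xi> = canonical_embedding x"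
  using assms unfolding reflexive_space_def by blast

text \<open>The inequality between \<open>f\<close> and its biconjugate at a point \<open>x\<close>,
  phrased without a second conjugate, which would be a function on the bidual.\<close>

lemma fenchel_moreau_le:
  fixes f :: "'a::real_normed_vector \<Rightarrow> ereal"
  assumes f: "proper_fun f" "econvex f" "lsc f"
    and le: "\<And>v. v \<in> edom (conjugate f) \<Longrightarrow> v x - real_of_ereal (conjugate f v) \<le> c"
  shows "f x \<le> ereal c"
proof (rule ccontr)
  assume "\<not> ?thesis"
  then obtain b where b: "ereal c < ereal b" "ereal b < f x"
    by (meson ereal_dense2 not_le)
  obtain u where u: "conjugate f u \<le> ereal (u x - b)" using fenchel_moreau[OF f b(2)] .
  then have "u \<in> edom (conjugate f)" by (auto simp: edom_def)
  moreover have "real_of_ereal (conjugate f u) \<le> u x - b"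
    using u ereal_real_of_proper[OF proper_conjugateI[OF f(1) calculation] calculation]
    by (metis ereal_less_eq(3))
  ultimately show False using le[of u] b(1) by simp
qed

text \<open>Left to right is biconjugation, right to left is Fenchel-Young. In a reflexive space
  every subgradient of the conjugate has this form, so the two subdifferentials are inverse to each
  other.\<close>

lemma canonical_embedding_in_subdiff_conjugate_iff:
  fixes f :: "'a::real_normed_vector \<Rightarrow> ereal"
  assumes f: "proper_fun f" "econvex f" "lsc f"
  shows "canonical_embedding x \<in> subdiff (conjugate f) v \<longleftrightarrow> v \<in> subdiff f x"
proof
  assume sub: "canonical_embedding x \<in> subdiff (conjugate f) v"
  then have v: "v \<in> edom (conjugate f)" by (simp add: subdiff_def)
  note proper = proper_conjugateI[OF f(1) v]
  let ?c = "real_of_ereal (conjugate f v)"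
  have "f x \<le> ereal (v x - ?c)"
  proof (rule fenchel_moreau_le[OF f])
    fix u assume "u \<in> edom (conjugate f)"
    then have "?c + (u - v) x \<le> real_of_ereal (conjugate f u)"
      using sub by (simp add: subdiff_iff[OF proper])
    then show "u x - real_of_ereal (conjugate f u) \<le> v x - ?c" by (simp add: blinfun.diff_left)
  qed
  moreover from this have x: "x \<in> edom f" by (auto simp: edom_def)
  ultimately have "real_of_ereal (f x) \<le> v x - ?c"
    using ereal_real_of_proper[OF f(1) x] by (metis ereal_less_eq(3))
  then have "ereal ?c \<le> ereal (v x - real_of_ereal (f x))" by simp
  then show "v \<in> subdiff f x"
    using x ereal_real_of_proper[OF proper v] by (simp add: subdiff_iff_conjugate[OF f(1)])
next
  assume "v \<in> subdiff f x"
  then have x: "x \<in> edom f" and le: "conjugate f v \<le> ereal (v x - real_of_ereal (f x))"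
    by (auto simp: subdiff_iff_conjugate[OF f(1)])
  then have v: "v \<in> edom (conjugate f)" by (auto simp: edom_def)
  note proper = proper_conjugateI[OF f(1) v]
  have "real_of_ereal (conjugate f v) + (u - v) x \<le> real_of_ereal (conjugate f u)"
    if u: "u \<in> edom (conjugate f)" for u
  proof -
    have "ereal (real_of_ereal (conjugate f v)) \<le> ereal (v x - real_of_ereal (f x))"
      using le ereal_real_of_proper[OF proper v] by simp
    moreover have "ereal (u x - real_of_ereal (f x)) \<le> ereal (real_of_ereal (conjugate f u))"
      using fenchel_young[OF f(1) x, of u] ereal_real_of_proper[OF proper u] by simp
    ultimately show ?thesis by (simp add: blinfun.diff_left)
  qed
  then show "canonical_embedding x \<in> subdiff (conjugate f) v"
    using v by (simp add: subdiff_iff[OF proper])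
qed

lemma bounded_above_near_conjugate:
  fixes f :: "'a::real_normed_vector \<Rightarrow> ereal"
  assumes "proper_fun f" "v \<in> interior (edom (conjugate f))"
  shows "bounded_above_near (conjugate f) v"
  using assms interior_subset
  by (intro bounded_above_near_interior proper_conjugateI[of f v] econvex_conjugate lsc_conjugate) auto

lemma interior_edom_conjugate_subset_ran_subdiff:
  fixes f :: "'a::real_normed_vector \<Rightarrow> ereal"
  assumes X: "reflexive_space TYPE('a)" and f: "proper_fun f" "econvex f" "lsc f"
    and v: "v \<in> interior (edom (conjugate f))"
  obtains x where "v \<in> subdiff f x"
proof -
  have "proper_fun (conjugate f)" using proper_conjugateI[OF f(1)] v interior_subset by blast
  then obtain \<xi> where \<xi>: "\<xi> \<in> subdiff (conjugate f) v"
    using subdiff_nonempty[OF _ econvex_conjugate[OF f(1)] bounded_above_near_conjugate[OF f(1) v]]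
    by blast
  obtain x where "\<xi> = canonical_embedding x" using reflexive_spaceE[OF X] .
  with \<xi> have "v \<in> subdiff f x" by (simp add: canonical_embedding_in_subdiff_conjugate_iff[OF f])
  then show ?thesis by (rule that)
qed

lemma subdiff_monotone:
  assumes f: "proper_fun f" and "v \<in> subdiff f x" "w \<in> subdiff f y"
  shows "0 \<le> (v - w) (x - y)"
proof -
  have "real_of_ereal (f x) + v (y - x) \<le> real_of_ereal (f y)"
    "real_of_ereal (f y) + w (x - y) \<le> real_of_ereal (f x)"
    using assms by (auto simp: subdiff_iff[OF f])
  then show ?thesis by (simp add: blinfun.diff_left blinfun.diff_right)
qed

text \<open>The supremum of \<open>n\<close> over the ball centred at 0 is
  \<open>R * norm n\<close>, and normality bounds it by \<open>n (y - a)\<close>.\<close>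

lemma norm_normal_cball_le:
  fixes n :: "'a::real_normed_vector \<Rightarrow>\<^sub>L real"
  assumes R: "R > 0" and n: "\<And>z. z \<in> cball a R \<Longrightarrow> n (z - y) \<le> 0"
  shows "R * norm n \<le> n (y - a)"
proof -
  have le: "n d \<le> n (y - a)" if "norm d \<le> R" for d
    using n[of "a + d"] that by (simp add: dist_norm blinfun.diff_right blinfun.add_right)
  have "n d \<le> n (y - a) / R * norm d" for d
  proof (cases "d = 0")
    case False
    have "n ((R / norm d) *\<^sub>R d) \<le> n (y - a)" using False R by (intro le) simp
    then show ?thesis using False R by (simp add: blinfun.scaleR_right field_simps)
  qed simp
  from this this[of "- _"] have "norm (n d) \<le> n (y - a) / R * norm d" for d
    by (simp add: blinfun.minus_right abs_le_iff)
  moreover have "0 \<le> n (y - a) / R" using le[of 0] R by simp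
  ultimately have "norm n \<le> n (y - a) / R" by (intro norm_blinfun_bound) auto
  then show ?thesis using R by (simp add: field_simps)
qed

text \<open>If \<open>w\<close> is close to \<open>v \<in> \<partial>f x\<^sub>0\<close>, minimise \<open>f - w\<close> over a large ball around \<open>x\<^sub>0\<close>: a minimiser
  \<open>y\<close> satisfies \<open>w = p + n\<close> with \<open>p \<in> \<partial>f y\<close> and \<open>n\<close> normal to the ball at \<open>y\<close>. Monotonicity forces
  \<open>norm n \<le> norm (w - v)\<close>, so local boundedness at \<open>v\<close> bounds \<open>y\<close>, the constraint is inactive,
  and \<open>n = 0\<close>.\<close>

lemma ex_subgradient_plus_normal:
  fixes f :: "'a::real_normed_vector \<Rightarrow> ereal"
  assumes X: "reflexive_space TYPE('a)" and f: "proper_fun f" "econvex f" "lsc f"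
    and v: "v \<in> subdiff f a" and R: "R > 0"
  obtains p y where "p \<in> subdiff f y" "y \<in> cball a R" "\<And>z. z \<in> cball a R \<Longrightarrow> (w - p) (z - y) \<le> 0"
proof -
  let ?F = "\<lambda>x. real_of_ereal (f x)"
  have a: "a \<in> edom f" using v by (simp add: subdiff_def)
  \<comment> \<open>\<open>f\<close> plus the indicator function of the ball.\<close>
  define h where "h z = (if z \<in> cball a R then f z else \<infinity>)" for z
  have edom_h: "edom h = edom f \<inter> cball a R" by (auto simp: edom_def h_def)
  have proper_h: "proper_fun h"
  proof -
    have "h z \<noteq> -\<infinity>" for z using f(1) by (simp add: h_def proper_fun_def)
    moreover have "a \<in> edom h" using a R by (simp add: edom_h)
    ultimately show ?thesis by (auto simp: proper_fun_def)
  qed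
  have "econvex h"
    unfolding econvex_def
  proof (intro allI impI)
    fix x y :: 'a and t :: real
    assume t: "0 < t" "t < 1"
    show "h ((1 - t) *\<^sub>R x + t *\<^sub>R y) \<le> ereal (1 - t) * h x + ereal t * h y"
    proof (cases "x \<in> cball a R \<and> y \<in> cball a R")
      case True
      then have "(1 - t) *\<^sub>R x + t *\<^sub>R y \<in> cball a R"
        using t by (intro convexD[OF convex_cball]) auto
      then show ?thesis using True f(2) t by (auto simp: h_def econvex_def simp del: mem_cball)
    next
      case False
      have "ereal s * h z \<noteq> -\<infinity>" if "s > 0" for s z
        using proper_h that by (cases "h z") (auto simp: proper_fun_def)
      moreover have "ereal (1 - t) * h x = \<infinity> \<or> ereal t * h y = \<infinity>"
        using False t by (auto simp: h_def simp del: mem_cball)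
      ultimately show ?thesis using t by auto
    qed
  qed
  have "lsc h"
    unfolding lsc_def
  proof
    fix c :: ereal
    show "open {x. c < h x}"
    proof (cases "c = \<infinity>")
      case False
      then have "{x. c < h x} = {x. c < f x} \<union> - cball a R"
        by (auto simp: h_def less_top[symmetric] top_ereal_def simp del: mem_cball)
      then show ?thesis using f(3) by (auto simp: lsc_def)
    qed simp
  qed
  \<comment> \<open>The subgradient \<open>v\<close> gives an affine minorant of \<open>f\<close>;
    on the bounded ball this makes every conjugate value finite, so the minimum of
    \<open>h - w\<close> is attained.\<close>
  have "edom (conjugate h) = UNIV"
  proof -
    have "conjugate h u \<le> ereal (norm (u - v) * (norm a + R) + v a - ?F a)" for u
      unfolding conjugate_le_iff[OF proper_h]
    proof
      fix z assume z: "z \<in> edom h"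
      then have "?F a + v (z - a) \<le> ?F z" using v by (auto simp: subdiff_iff[OF f(1)] edom_h)
      moreover have "(u - v) z \<le> norm (u - v) * (norm a + R)"
      proof -
        have "norm z \<le> norm a + R"
          using z norm_triangle_ineq[of a "z - a"] by (simp add: edom_h dist_norm norm_minus_commute)
        then have "norm (u - v) * norm z \<le> norm (u - v) * (norm a + R)"
          by (intro mult_left_mono) auto
        then show ?thesis using norm_blinfun[of "u - v" z] by simp
      qed
      moreover have "h z = f z" using z by (simp add: h_def edom_h)
      ultimately show "u z - real_of_ereal (h z) \<le> norm (u - v) * (norm a + R) + v a - ?F a"
        by (simp add: blinfun.diff_left blinfun.diff_right)
    qed
    then have "conjugate h u \<noteq> \<infinity>" for u by (metis PInfty_neq_ereal(1) ereal_infty_less_eq(1))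
    then show ?thesis by (simp add: edom_def)
  qed
  then obtain y where y: "w \<in> subdiff h y"
    using interior_edom_conjugate_subset_ran_subdiff[OF X proper_h \<open>econvex h\<close> \<open>lsc h\<close>, of w] by auto
  then have y_mem: "y \<in> edom f" "y \<in> cball a R"
    and min: "\<And>z. z \<in> edom f \<Longrightarrow> z \<in> cball a R \<Longrightarrow> ?F y + w (z - y) \<le> ?F z"
    by (auto simp: subdiff_iff[OF proper_h] edom_h h_def)
  let ?H = "{(z, s). f z \<le> ereal (- s)}"
  let ?g = "\<lambda>z. - w (z - y) - ?F y"
  \<comment> \<open>The sum rule for \<open>f\<close> and the indicator function: \<open>- f\<close>
    and the affine upper function touch at \<open>y\<close>, so the separating slope is
    \<open>- p\<close> with \<open>w - p\<close> normal to the ball. The centre \<open>a\<close>,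
    lying in the domain of \<open>f\<close>, supplies the ball that \<open>sandwich\<close>
    needs.\<close>
  obtain l :: "'a \<Rightarrow>\<^sub>L real" and c where l: "\<And>z. z \<in> cball a R \<Longrightarrow> l z + c \<le> ?g z"
    and H: "\<And>z s. (z, s) \<in> ?H \<Longrightarrow> s \<le> l z + c"
  proof (rule sandwich[OF _ convex_hypograph_uminus[OF f(2)]])
    show "convex_on (cball a R) ?g"
      unfolding convex_on_def
    proof (intro conjI ballI allI impI)
      fix x1 x2 and s t :: real
      assume "s + t = 1"
      then have eq: "s = 1 - t" by simp
      show "?g (s *\<^sub>R x1 + t *\<^sub>R x2) \<le> s * ?g x1 + t * ?g x2"
        unfolding eq by (simp add: blinfun.diff_right blinfun.add_right blinfun.scaleR_right algebra_simps)
    qed simp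
    show "s \<le> ?g z" if "z \<in> cball a R" "(z, s) \<in> ?H" for z s
    proof -
      have z: "z \<in> edom f" using that(2) by (auto simp: edom_def)
      then have "?F z \<le> - s"
        using that(2) ereal_real_of_proper[OF f(1) z] by (metis (no_types, lifting) case_prodD ereal_less_eq(3) mem_Collect_eq)
      then show ?thesis using min[OF z that(1)] by simp
    qed
    show "(a, - ?F a) \<in> ?H" using ereal_real_of_proper[OF f(1) a] by simp
    show "R > 0" by (rule R)
    show "z \<in> cball a R \<and> ?g z \<le> norm w * (R + norm (a - y)) - ?F y" if "z \<in> ball a R" for z
    proof -
      have "norm (y - z) \<le> norm (a - z) + norm (a - y)"
        using norm_triangle_ineq4[of "a - z" "a - y"] by simp
      also have "\<dots> \<le> R + norm (a - y)" using that by (simp add: dist_norm)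
      finally have "norm w * norm (y - z) \<le> norm w * (R + norm (a - y))" by (intro mult_left_mono) auto
      moreover have "- w (z - y) \<le> norm w * norm (y - z)"
        using norm_blinfun[of w "y - z"] by (simp add: blinfun.diff_right)
      ultimately show ?thesis using that by simp
    qed
  qed blast
  have H': "- ?F z \<le> l z + c" if "z \<in> edom f" for z
    using H[of z "- ?F z"] ereal_real_of_proper[OF f(1) that] by simp
  have eq: "l y + c = - ?F y" using H'[OF y_mem(1)] l[OF y_mem(2)] by simp
  have "- l \<in> subdiff f y"
    using H' eq y_mem(1)
    by (fastforce simp: subdiff_iff[OF f(1)] blinfun.minus_left blinfun.diff_right)
  moreover have "(w - (- l)) (z - y) \<le> 0" if "z \<in> cball a R" for z
    using l[OF that] eq by (simp add: blinfun.diff_left blinfun.diff_right blinfun.add_left)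
  ultimately show ?thesis using that y_mem(2) by blast
qed

lemma dom_subdiff_conjugate_interior:
  fixes f :: "'a::real_normed_vector \<Rightarrow> ereal"
  assumes X: "reflexive_space TYPE('a)" and f: "proper_fun f" "econvex f" "lsc f"
    and bdd: "locally_bounded_on (sv_dom (sv_inv (subdiff f))) (sv_inv (subdiff f))"
    and v: "v \<in> subdiff f a"
  shows "v \<in> interior (edom (conjugate f))"
proof -
  have "v \<in> sv_dom (sv_inv (subdiff f))" using v by (auto simp: sv_dom_def sv_inv_def)
  then obtain U where U: "open U" "v \<in> U" "bounded (sv_image (sv_inv (subdiff f)) U)"
    using bdd unfolding locally_bounded_on_def by blast
  obtain M where "\<And>x. x \<in> sv_image (sv_inv (subdiff f)) U \<Longrightarrow> norm x \<le> M"
    using U(3) by (auto simp: bounded_iff)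
  then have M: "norm x \<le> M" if "p \<in> U" "p \<in> subdiff f x" for p x
    using that by (auto simp: sv_image_def sv_inv_def)
  obtain r where r: "r > 0" "ball v r \<subseteq> U"
    using U(1,2) by (auto simp: open_contains_ball)
  \<comment> \<open>Any \<open>y\<close> with a subgradient in \<open>U\<close> satisfies
    \<open>norm y \<le> M\<close>, hence lies strictly inside the ball of radius \<open>R\<close>
    around \<open>a\<close>.\<close>
  define R where "R = M + norm a + 1"
  have "norm a \<le> M" using M v U(2) by blast
  then have R: "R > 0" unfolding R_def using norm_ge_zero[of a] by linarith
  \<comment> \<open>Half the radius, because \<open>p\<close> can be up to twice as far from
    \<open>v\<close> as \<open>w\<close> is.\<close>
  have "ball v (r / 2) \<subseteq> edom (conjugate f)"
  proof
    fix w assume w: "w \<in> ball v (r / 2)"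
    obtain p y where p: "p \<in> subdiff f y" and y: "y \<in> cball a R"
      and n: "\<And>z. z \<in> cball a R \<Longrightarrow> (w - p) (z - y) \<le> 0"
      using ex_subgradient_plus_normal[OF X f v R] by blast
    have n_le: "R * norm (w - p) \<le> (w - p) (y - a)" by (rule norm_normal_cball_le[OF R n])
    also have "\<dots> \<le> (w - v) (y - a)"
      using subdiff_monotone[OF f(1) p v] by (simp add: blinfun.diff_left)
    also have "\<dots> \<le> norm (w - v) * norm (y - a)" using norm_blinfun[of "w - v" "y - a"] by simp
    also have "\<dots> \<le> norm (w - v) * R"
      using y by (intro mult_left_mono) (auto simp: dist_norm norm_minus_commute)
    finally have "norm (w - p) \<le> norm (w - v)" using R by (simp add: mult.commute)
    then have "dist v p < r"
      using w norm_triangle_ineq4[of "w - v" "w - p"] by (simp add: dist_norm norm_minus_commute)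
    then have "norm y \<le> M" using r(2) by (intro M[OF _ p]) auto
    then have lt: "norm (y - a) < R" using norm_triangle_ineq4[of y a] by (simp add: R_def)
    have "w - p = 0"
    proof (rule ccontr)
      assume "w - p \<noteq> 0"
      then have "norm (w - p) * norm (y - a) < norm (w - p) * R" using lt by simp
      then show False using n_le norm_blinfun[of "w - p" "y - a"] by (simp add: mult.commute)
    qed
    then have "w \<in> subdiff f y" using p by simp
    then show "w \<in> edom (conjugate f)" by (auto simp: subdiff_iff_conjugate[OF f(1)] edom_def)
  qed
  then show ?thesis using r(1) by (auto simp: mem_interior intro!: exI[of _ "r / 2"])
qed

section \<open>Maximally monotone operators\<close>

lemma maximally_monotone_memI:
  assumes T: "maximally_monotone T" and vx: "\<And>b u. u \<in> T b \<Longrightarrow> 0 \<le> (v - u) (x - b)"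
  shows "v \<in> T x"
proof (rule ccontr)
  assume v: "v \<notin> T x"
  define S where "S = T(x := insert v (T x))"
  have "sv_monotone S"
    unfolding sv_monotone_def
  proof (intro allI ballI)
    fix a b u w assume uw: "u \<in> S a" "w \<in> S b"
    have flip: "(u - w) (a - b) = (w - u) (b - a)" by (simp add: blinfun.diff_left blinfun.diff_right)
    from uw consider "u \<in> T a" "w \<in> T b" | "a = x" "u = v" "b = x" "w = v"
      | "a = x" "u = v" "w \<in> T b" | "b = x" "w = v" "u \<in> T a"
      by (auto simp: S_def split: if_splits)
    then show "0 \<le> (u - w) (a - b)"
    proof cases
      case 1
      then show ?thesis using T by (auto simp: maximally_monotone_def sv_monotone_def)
    next
      case 4
      then show ?thesis using vx[of u a] flip by simp
    qed (use vx in auto)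
  qed
  moreover have "sv_graph T \<subset> sv_graph S"
    using v by (auto simp: sv_graph_def S_def)
  ultimately show False using T by (auto simp: maximally_monotone_def)
qed

lemma maximally_monotone_scale:
  assumes T: "maximally_monotone T" and "lam > 0"
  shows "maximally_monotone (sv_scale lam T)"
  unfolding maximally_monotone_def
proof (intro conjI notI)
  show "sv_monotone (sv_scale lam T)"
    using T \<open>lam > 0\<close>
    by (auto simp: maximally_monotone_def sv_monotone_def sv_scale_def blinfun.scaleR_left
        simp flip: scaleR_diff_right)
  assume "\<exists>S. sv_monotone S \<and> sv_graph (sv_scale lam T) \<subset> sv_graph S"
  then obtain S x v where S: "sv_monotone S" "sv_graph (sv_scale lam T) \<subseteq> sv_graph S"
    and v: "v \<in> S x" "v \<notin> sv_scale lam T x"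
    by (auto simp: sv_graph_def)
  have "v /\<^sub>R lam \<in> T x"
  proof (rule maximally_monotone_memI[OF T])
    fix b u assume "u \<in> T b"
    then have "lam *\<^sub>R u \<in> S b" using S(2) by (auto simp: sv_graph_def sv_scale_def)
    then have "0 \<le> (v - lam *\<^sub>R u) (x - b)" using S(1) v(1) by (auto simp: sv_monotone_def)
    also have "v - lam *\<^sub>R u = lam *\<^sub>R (v /\<^sub>R lam - u)" using \<open>lam > 0\<close> by (simp add: algebra_simps)
    finally show "0 \<le> (v /\<^sub>R lam - u) (x - b)"
      using \<open>lam > 0\<close> by (simp only: blinfun.scaleR_left) (simp add: zero_le_mult_iff)
  qed
  then show False using v(2) \<open>lam > 0\<close> by (auto simp: sv_scale_def image_iff intro!: bexI[of _ "v /\<^sub>R lam"])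
qed

text \<open>Rockafellar's surjectivity argument by Fenchel duality on \<open>X \<times> X\<^sup>*\<close>: the Fitzpatrick function
  of \<open>T\<close> dominates the pairing, hence also \<open>(x, v) \<mapsto> w x - f x - f\<^sup>* (w - v)\<close>, and the coefficients
  of a separating affine function solve the inclusion. The set \<open>H\<close> below is the hypograph of
  the negative of the Fitzpatrick function.\<close>

lemma maximally_monotone_plus_subdiff_surj:
  fixes f :: "'a::banach \<Rightarrow> ereal"
  assumes X: "reflexive_space TYPE('a)" and f: "proper_fun f" "econvex f" "lsc f"
    and T: "maximally_monotone T" and a: "a' \<in> T a" "a \<in> interior (edom f)"
    and wa: "w - a' \<in> interior (edom (conjugate f))"
  obtains y v where "v \<in> T y" "w - v \<in> subdiff f y"
proof -
  let ?F = "\<lambda>x. real_of_ereal (f x)" and ?G = "\<lambda>v. real_of_ereal (conjugate f v)"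
  have mono: "0 \<le> (v - u) (x - b)" if "v \<in> T x" "u \<in> T b" for x b u v
    using T that by (auto simp: maximally_monotone_def sv_monotone_def)
  have "w - a' \<in> edom (conjugate f)" using wa interior_subset by blast
  note proper = proper_conjugateI[OF f(1) this] and wa' = this
  note cvx = convex_on_real_of_econvex[OF f(1,2)]
    convex_on_real_of_econvex[OF proper econvex_conjugate[OF f(1)]]
  have young: "v x \<le> ?F x + ?G v" if "x \<in> edom f" "v \<in> edom (conjugate f)" for x v
    using fenchel_young[OF f(1) that(1), of v] ereal_real_of_proper[OF proper that(2)]
    by (metis diff_le_eq add.commute ereal_less_eq(3))
  define C where "C = {(x, v). x \<in> edom f \<and> w - v \<in> edom (conjugate f)}"
  define g where "g = (\<lambda>(x, v). ?F x + ?G (w - v) - w x)"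
  define H where "H = {((x, v), s). \<forall>b. \<forall>u\<in>T b. s \<le> u b - u x - blinfun_apply v b}"
  have cvx_g: "convex_on C g"
    unfolding convex_on_def
  proof (intro conjI ballI allI impI)
    have *: "w - (s *\<^sub>R v + t *\<^sub>R v') = s *\<^sub>R (w - v) + t *\<^sub>R (w - v')" if "s + t = 1"
      for v v' :: "'a \<Rightarrow>\<^sub>L real" and s t :: real
    proof -
      have s: "s = 1 - t" using that by simp
      show ?thesis unfolding s by (simp add: algebra_simps)
    qed
    show "convex C"
      using convex_on_imp_convex[OF cvx(1)] convex_on_imp_convex[OF cvx(2)] *
      by (auto simp: C_def convex_def)
    fix p q and s t :: real
    assume pq: "p \<in> C" "q \<in> C" and st: "0 \<le> s" "0 \<le> t" "s + t = 1"
    obtain x v x' v' where eq: "p = (x, v)" "q = (x', v')" by fastforce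
    have "?F (s *\<^sub>R x + t *\<^sub>R x') \<le> s * ?F x + t * ?F x'"
      using cvx(1) pq st by (auto simp: convex_on_def C_def eq)
    moreover have "?G (w - (s *\<^sub>R v + t *\<^sub>R v')) \<le> s * ?G (w - v) + t * ?G (w - v')"
      using cvx(2) pq st unfolding *[OF st(3)] by (auto simp: convex_on_def C_def eq)
    ultimately show "g (s *\<^sub>R p + t *\<^sub>R q) \<le> s * g p + t * g q"
      by (simp add: eq g_def blinfun.add_right blinfun.scaleR_right algebra_simps)
  qed
  have "convex H"
  proof (rule convexI)
    fix p q :: "('a \<times> ('a \<Rightarrow>\<^sub>L real)) \<times> real" and s t :: real
    assume pq: "p \<in> H" "q \<in> H" and st: "0 \<le> s" "0 \<le> t" "s + t = 1"
    obtain x v k x' v' k' where eq: "p = ((x, v), k)" "q = ((x', v'), k')" by (metis surj_pair)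
    have "s * k + t * k' \<le> u b - u (s *\<^sub>R x + t *\<^sub>R x') - (s *\<^sub>R v + t *\<^sub>R v') b" if "u \<in> T b" for u b
    proof -
      have "s * k + t * k' \<le> s * (u b - u x - v b) + t * (u b - u x' - v' b)"
        using pq st that by (intro add_mono mult_left_mono) (auto simp: H_def eq)
      also have "\<dots> = (s + t) * u b - u (s *\<^sub>R x + t *\<^sub>R x') - (s *\<^sub>R v + t *\<^sub>R v') b"
        by (simp add: blinfun.add_left blinfun.add_right blinfun.scaleR_left blinfun.scaleR_right algebra_simps)
      finally show ?thesis using st by simp
    qed
    then show "s *\<^sub>R p + t *\<^sub>R q \<in> H" by (simp add: H_def eq)
  qed
  moreover have "s \<le> g p" if p: "p \<in> C" "(p, s) \<in> H" for p s
  proof -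
    obtain x v where eq: "p = (x, v)" by fastforce
    \<comment> \<open>The Fitzpatrick function dominates the pairing: a graph point tests itself,
      and for any other point maximality supplies a test pair.\<close>
    have "\<exists>b. \<exists>u\<in>T b. (v - u) (x - b) \<le> 0"
    proof (cases "v \<in> T x")
      case False
      then show ?thesis using maximally_monotone_memI[OF T, of v x] by (meson linear)
    qed (auto intro!: exI[of _ x] bexI[of _ v])
    then obtain b u where "u \<in> T b" "(v - u) (x - b) \<le> 0" by blast
    moreover have "s \<le> u b - u x - v b" using p \<open>u \<in> T b\<close> by (auto simp: H_def eq)
    moreover have "(w - v) x \<le> ?F x + ?G (w - v)" using p(1) by (intro young) (auto simp: C_def eq)
    ultimately show ?thesis by (simp add: g_def eq blinfun.diff_left blinfun.diff_right)
  qed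
  moreover have "((a, a'), - a' a) \<in> H"
    using mono[OF a(1)] by (fastforce simp: H_def blinfun.diff_left blinfun.diff_right)
  moreover obtain r M where "r > 0" "\<And>p. p \<in> ball (a, a') r \<Longrightarrow> p \<in> C \<and> g p \<le> M"
  proof -
    obtain r1 M1 where 1: "r1 > 0" "\<And>x. x \<in> ball a r1 \<Longrightarrow> x \<in> edom f \<and> ?F x \<le> M1"
      using bounded_above_nearE[OF bounded_above_near_interior[OF f a(2)] f(1)] by blast
    obtain r2 M2 where 2: "r2 > 0"
      "\<And>v. v \<in> ball (w - a') r2 \<Longrightarrow> v \<in> edom (conjugate f) \<and> ?G v \<le> M2"
      using bounded_above_nearE[OF bounded_above_near_conjugate[OF f(1) wa] proper] by blast
    have "p \<in> C \<and> g p \<le> M1 + M2 + norm w * (norm a + r1)" if p: "p \<in> ball (a, a') (min r1 r2)" for p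
    proof -
      obtain x v where eq: "p = (x, v)" by fastforce
      have d: "dist a x < r1" "dist a' v < r2"
        using p dist_fst_le[of "(a, a')" p] dist_snd_le[of "(a, a')" p] by (auto simp: eq)
      have x: "x \<in> edom f" "?F x \<le> M1" using 1(2)[of x] d by auto
      have v: "w - v \<in> edom (conjugate f)" "?G (w - v) \<le> M2"
        using 2(2)[of "w - v"] d by (auto simp: dist_norm norm_minus_commute)
      have "norm x \<le> norm a + r1"
        using d(1) norm_triangle_ineq[of a "x - a"] by (simp add: dist_norm norm_minus_commute)
      then have "norm w * norm x \<le> norm w * (norm a + r1)" by (intro mult_left_mono) auto
      moreover have "- w x \<le> norm w * norm x" using norm_blinfun[of w x] by simp
      ultimately show ?thesis using x v by (simp add: C_def g_def eq)
    qed
    moreover have "min r1 r2 > 0" using 1 2 by simp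
    ultimately show ?thesis using that by blast
  qed
  ultimately obtain l :: "('a \<times> ('a \<Rightarrow>\<^sub>L real)) \<Rightarrow>\<^sub>L real" and c
    where lC: "\<And>p. p \<in> C \<Longrightarrow> l p + c \<le> g p" and lH: "\<And>p s. (p, s) \<in> H \<Longrightarrow> s \<le> l p + c"
    using sandwich[OF cvx_g, of H "(a, a')" "- a' a" r M] by blast
  \<comment> \<open>The two components of \<open>l\<close> become \<open>z\<close> in the dual and,
    by reflexivity, a point \<open>y\<close> of the space; the signs are chosen so that
    \<open>(y, z)\<close> is the graph point sought.\<close>
  define z where "z = Blinfun (\<lambda>x. - l (x, 0))"
  have "bounded_linear (\<lambda>x. - l (x, 0))"
    by (intro bounded_linear_minus bounded_linear_compose[OF blinfun.bounded_linear_right]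
        bounded_linear_Pair bounded_linear_ident bounded_linear_zero)
  then have z: "z x = - l (x, 0)" for x by (simp add: z_def bounded_linear_Blinfun_apply)
  have "bounded_linear (\<lambda>v :: 'a \<Rightarrow>\<^sub>L real. - l (0, v))"
    by (intro bounded_linear_minus bounded_linear_compose[OF blinfun.bounded_linear_right]
        bounded_linear_Pair bounded_linear_ident bounded_linear_zero)
  then obtain y where y: "v y = - l (0, v)" for v :: "'a \<Rightarrow>\<^sub>L real"
    using reflexive_spaceE[OF X, of "Blinfun (\<lambda>v :: 'a \<Rightarrow>\<^sub>L real. - l (0, v))"]
    by (metis bounded_linear_Blinfun_apply canonical_embedding_apply)
  have l: "l (x, v) = - z x - v y" for x v
    using blinfun.add_right[of l "(x, 0)" "(0, v)"] by (simp add: z y)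
  have graph: "z b + u y - u b \<le> c" if "u \<in> T b" for u b
  proof -
    have "((b, u), - u b) \<in> H"
      using mono[OF that] by (fastforce simp: H_def blinfun.diff_left blinfun.diff_right)
    from lH[OF this] show ?thesis by (simp add: l)
  qed
  \<comment> \<open>The supremum over \<open>x\<close> is \<open>conjugate f (w - z)\<close>, the
    one over \<open>v\<close> the biconjugate at \<open>y\<close>: the affine bound on
    \<open>g\<close> becomes an upper bound for \<open>?F y + ?G (w - z)\<close>.\<close>
  have dual: "(w - z) x - ?F x \<le> w y - c - v y + ?G v" if "x \<in> edom f" "v \<in> edom (conjugate f)" for x v
    using lC[of "(x, w - v)"] that by (simp add: C_def g_def l blinfun.diff_left)
  have "conjugate f (w - z) \<le> ereal (w y - c - (w - a') y + ?G (w - a'))"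
    unfolding conjugate_le_iff[OF f(1)] using dual[OF _ wa'] by blast
  then have wz: "w - z \<in> edom (conjugate f)" by (auto simp: edom_def)
  have G_le: "?G (w - z) \<le> w y - c - v y + ?G v" if "v \<in> edom (conjugate f)" for v
  proof -
    have "conjugate f (w - z) \<le> ereal (w y - c - v y + ?G v)"
      unfolding conjugate_le_iff[OF f(1)] using dual[OF _ that] by blast
    then show ?thesis using ereal_real_of_proper[OF proper wz] by (metis ereal_less_eq(3))
  qed
  have f_le: "f y \<le> ereal (w y - c - ?G (w - z))"
    using G_le by (intro fenchel_moreau_le[OF f]) (simp add: algebra_simps)
  then have y_mem: "y \<in> edom f" by (auto simp: edom_def)
  then have F_le: "?F y \<le> w y - c - ?G (w - z)"
    using f_le ereal_real_of_proper[OF f(1)] by (metis ereal_less_eq(3))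
  then have "c \<le> z y" using young[OF y_mem wz] by (simp add: blinfun.diff_left)
  have "z \<in> T y"
  proof (rule maximally_monotone_memI[OF T])
    fix b u assume "u \<in> T b"
    from graph[OF this] \<open>c \<le> z y\<close> show "0 \<le> (z - u) (y - b)"
      by (simp add: blinfun.diff_left blinfun.diff_right)
  qed
  \<comment> \<open>Now \<open>graph\<close> applies to the pair \<open>(y, z)\<close> itself and
    gives \<open>z y \<le> c\<close>; so \<open>c = z y\<close>, and \<open>F_le\<close> is
    Fenchel-Young with equality.\<close>
  moreover have "w - z \<in> subdiff f y"
  proof -
    have "?G (w - z) \<le> (w - z) y - ?F y"
      using F_le graph[OF \<open>z \<in> T y\<close>] by (simp add: blinfun.diff_left)
    then show ?thesis
      using ereal_real_of_proper[OF proper wz] y_mem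
      by (simp add: subdiff_iff_conjugate[OF f(1)]) (metis ereal_less_eq(3))
  qed
  ultimately show ?thesis by (rule that)
qed

section \<open>Legendre functions and right resolvents\<close>

locale legendre_function =
  fixes \<Psi> :: "'a::banach \<Rightarrow> ereal"
  assumes reflexive: "reflexive_space TYPE('a)"
    and Gamma_G: "\<Psi> \<in> Gamma_G"
    and strictly_convex: "strictly_econvex_on (interior (edom \<Psi>)) \<Psi>"
    and Euler_Legendre: "Euler_Legendre \<Psi>"
begin

lemma proper: "proper_fun \<Psi>"
  and convex: "econvex \<Psi>"
  and lower_semicontinuous: "lsc \<Psi>"
  and gateaux_nonempty: "x \<in> interior (edom \<Psi>) \<Longrightarrow> gateaux \<Psi> x \<noteq> {}"
  using Gamma_G by (auto simp: Gamma_G_def)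

text \<open>At a boundary point of the domain, adding a support functional of the domain to a
  subgradient gives a second subgradient.\<close>

lemma subdiff_interior:
  assumes v: "v \<in> subdiff \<Psi> x"
  shows "x \<in> interior (edom \<Psi>)"
proof (rule ccontr)
  assume x: "x \<notin> interior (edom \<Psi>)"
  have EG: "interior (edom \<Psi>) \<noteq> {}" "single_valued_on_dom (subdiff \<Psi>)"
    using Euler_Legendre by (auto simp: Euler_Legendre_def essentially_gateaux_def)
  then obtain a where a: "a \<in> interior (edom \<Psi>)" by blast
  have "x \<in> edom \<Psi>" using v by (simp add: subdiff_def)
  then obtain l :: "'a \<Rightarrow>\<^sub>L real" where l: "l \<noteq> 0" "\<And>z. z \<in> edom \<Psi> \<Longrightarrow> l (z - x) \<le> 0"
    using support_functional[OF convex_edom[OF proper convex] a _ x] by blast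
  have "v + l \<in> subdiff \<Psi> x"
    using v l(2) by (force simp: subdiff_iff[OF proper] blinfun.add_left)
  then show False
    using v l(1) EG(2) by (auto simp: single_valued_on_dom_def sv_dom_def)
qed

lemma subdiff_eq_gateaux: "subdiff \<Psi> x = gateaux \<Psi> x"
proof
  show "gateaux \<Psi> x \<subseteq> subdiff \<Psi> x" by (rule gateaux_subset_subdiff[OF proper convex])
  show "subdiff \<Psi> x \<subseteq> gateaux \<Psi> x"
    using subdiff_interior gateaux_nonempty subdiff_gateaux_eq[OF proper] by blast
qed

lemma gateaux_unique: "v \<in> gateaux \<Psi> x \<Longrightarrow> w \<in> gateaux \<Psi> x \<Longrightarrow> v = w"
  using subdiff_gateaux_eq[OF proper] by (simp add: subdiff_eq_gateaux)

text \<open>The affine minorants with slope \<open>v\<close> at \<open>x\<close> and at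
  \<open>y\<close>, averaged at the midpoint, contradict strict convexity there.\<close>

lemma gateaux_inj:
  assumes "v \<in> gateaux \<Psi> x" "v \<in> gateaux \<Psi> y"
  shows "x = y"
proof (rule ccontr)
  assume "x \<noteq> y"
  let ?F = "\<lambda>x. real_of_ereal (\<Psi> x)"
  have v: "v \<in> subdiff \<Psi> x" "v \<in> subdiff \<Psi> y" using assms by (auto simp: subdiff_eq_gateaux)
  then have xy: "x \<in> interior (edom \<Psi>)" "y \<in> interior (edom \<Psi>)" by (auto intro: subdiff_interior)
  define m where "m = (1 - 1 / 2) *\<^sub>R x + (1 / 2 :: real) *\<^sub>R y"
  have mem: "x \<in> edom \<Psi>" "y \<in> edom \<Psi>" using xy interior_subset by auto
  have m: "m \<in> edom \<Psi>"
    unfolding m_def using mem by (intro convexD[OF convex_edom[OF proper convex]]) auto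
  have "\<Psi> m < ereal (1 - 1 / 2) * \<Psi> x + ereal (1 / 2) * \<Psi> y"
    unfolding m_def
    by (rule strictly_convex[unfolded strictly_econvex_on_def, rule_format, OF xy \<open>x \<noteq> y\<close>]) auto
  moreover obtain r s t where "\<Psi> x = ereal r" "\<Psi> y = ereal s" "\<Psi> m = ereal t"
    using ereal_real_of_proper[OF proper] mem m by metis
  ultimately have "2 * ?F m < ?F x + ?F y" by simp
  moreover have "?F x + v (m - x) \<le> ?F m" "?F y + v (m - y) \<le> ?F m"
    using v m by (auto simp: subdiff_iff[OF proper])
  moreover have "v (m - x) + v (m - y) = 0"
    by (simp add: m_def blinfun.diff_right blinfun.add_right blinfun.scaleR_right)
  ultimately show False by linarith
qed

lemma gateaux_conjugate_interior: "v \<in> gateaux \<Psi> x \<Longrightarrow> v \<in> interior (edom (conjugate \<Psi>))"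
  using dom_subdiff_conjugate_interior[OF reflexive proper convex lower_semicontinuous]
    Euler_Legendre
  by (simp add: Euler_Legendre_def essentially_strictly_convex_def subdiff_eq_gateaux)

lemma ran_gateaux: "sv_ran (gateaux \<Psi>) = interior (edom (conjugate \<Psi>))"
proof
  show "sv_ran (gateaux \<Psi>) \<subseteq> interior (edom (conjugate \<Psi>))"
    using gateaux_conjugate_interior by (auto simp: sv_ran_def)
  show "interior (edom (conjugate \<Psi>)) \<subseteq> sv_ran (gateaux \<Psi>)"
  proof
    fix v assume "v \<in> interior (edom (conjugate \<Psi>))"
    then obtain x where "v \<in> subdiff \<Psi> x"
      using interior_edom_conjugate_subset_ran_subdiff[OF reflexive proper convex lower_semicontinuous]
      by blast
    then show "v \<in> sv_ran (gateaux \<Psi>)" by (auto simp: sv_ran_def subdiff_eq_gateaux)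
  qed
qed

text \<open>Differentiability of the conjugate is injectivity of \<open>gateaux \<Psi>\<close> seen
  from the dual side: only one point has gradient \<open>v\<close>, so the conjugate has a single
  subgradient at \<open>v\<close>.\<close>

lemma mem_dual_gateaux_iff: "x \<in> dual_gateaux (conjugate \<Psi>) v \<longleftrightarrow> v \<in> gateaux \<Psi> x"
proof
  note canonical = canonical_embedding_in_subdiff_conjugate_iff[OF proper convex lower_semicontinuous,
      unfolded subdiff_eq_gateaux]
  note convex_conj = econvex_conjugate[OF proper]
  {
    assume "x \<in> dual_gateaux (conjugate \<Psi>) v"
    then have x: "canonical_embedding x \<in> gateaux (conjugate \<Psi>) v" by (simp add: dual_gateaux_def)
    then have "v \<in> edom (conjugate \<Psi>)" using interior_subset by (auto simp: gateaux_def)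
    from gateaux_subset_subdiff[OF proper_conjugateI[OF proper this] convex_conj] x
    show "v \<in> gateaux \<Psi> x" using canonical by blast
  next
    assume v: "v \<in> gateaux \<Psi> x"
    then have int: "v \<in> interior (edom (conjugate \<Psi>))" by (rule gateaux_conjugate_interior)
    then have "proper_fun (conjugate \<Psi>)" using proper_conjugateI[OF proper] interior_subset by blast
    moreover have "subdiff (conjugate \<Psi>) v = {canonical_embedding x}"
    proof (intro equalityI subsetI)
      fix \<xi> assume "\<xi> \<in> subdiff (conjugate \<Psi>) v"
      moreover obtain z where "\<xi> = canonical_embedding z" using reflexive_spaceE[OF reflexive] .
      ultimately show "\<xi> \<in> {canonical_embedding x}" using canonical gateaux_inj[OF v] by blast
    qed (use canonical v in blast)
    ultimately show "x \<in> dual_gateaux (conjugate \<Psi>) v"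
      using unique_subgradient_imp_gateaux[OF _ convex_conj bounded_above_near_conjugate[OF proper int]]
      by (simp add: dual_gateaux_def)
  }
qed

lemma dual_gateaux_eq: "v \<in> gateaux \<Psi> x \<Longrightarrow> dual_gateaux (conjugate \<Psi>) v = {x}"
  using mem_dual_gateaux_iff gateaux_inj by blast

section \<open>The right resolvent of a monotone map\<close>

lemma mem_right_resolvent_iff:
  "p \<in> right_resolvent \<Psi> T x \<longleftrightarrow> (\<exists>z. p \<in> gateaux \<Psi> z \<and> x - p \<in> T z)"
proof -
  have "p \<in> right_resolvent \<Psi> T x \<longleftrightarrow> (\<exists>z w. p \<in> gateaux \<Psi> z \<and> w \<in> T z \<and> x = p + w)"
    by (auto simp: right_resolvent_def sv_inv_def sv_add_def sv_comp_def Bex_def mem_dual_gateaux_iff)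
  also have "\<dots> \<longleftrightarrow> (\<exists>z. p \<in> gateaux \<Psi> z \<and> x - p \<in> T z)"
    by (metis add_diff_cancel_left' add.commute diff_add_cancel)
  finally show ?thesis .
qed

lemma sv_dom_right_resolvent: "sv_dom (right_resolvent \<Psi> T) = sv_ran (sv_add (gateaux \<Psi>) T)"
proof -
  have "x \<in> sv_ran (sv_add (gateaux \<Psi>) T) \<longleftrightarrow> (\<exists>p z. p \<in> gateaux \<Psi> z \<and> x - p \<in> T z)" for x
    by (auto simp: sv_ran_def sv_add_def) (metis add_diff_cancel_left' add.commute diff_add_cancel)+
  moreover have "x \<in> sv_dom (right_resolvent \<Psi> T) \<longleftrightarrow> (\<exists>p z. p \<in> gateaux \<Psi> z \<and> x - p \<in> T z)" for x
    using mem_right_resolvent_iff by (auto simp: sv_dom_def)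
  ultimately show ?thesis by blast
qed

lemma sv_ran_right_resolvent: "sv_ran (right_resolvent \<Psi> T) \<subseteq> interior (edom (conjugate \<Psi>))"
  using gateaux_conjugate_interior by (auto simp: sv_ran_def mem_right_resolvent_iff)

text \<open>Monotonicity of \<open>T\<close> gives \<open>(p - q) (y - z) \<le> 0\<close>, the
  reverse of what subgradients satisfy. Chaining the two subgradient inequalities then makes
  \<open>q\<close> a subgradient at \<open>y\<close> as well, where \<open>p\<close> is the only
  one.\<close>

lemma right_resolvent_unique:
  assumes T: "sv_monotone T" and pq: "p \<in> right_resolvent \<Psi> T x" "q \<in> right_resolvent \<Psi> T x"
  shows "p = q"
proof -
  obtain y z where y: "p \<in> gateaux \<Psi> y" "x - p \<in> T y" and z: "q \<in> gateaux \<Psi> z" "x - q \<in> T z"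
    using pq by (auto simp: mem_right_resolvent_iff)
  have "0 \<le> ((x - p) - (x - q)) (y - z)"
    using T y(2) z(2) unfolding sv_monotone_def by blast
  then have le: "(p - q) (y - z) \<le> 0" by (simp add: blinfun.diff_left)
  let ?F = "\<lambda>x. real_of_ereal (\<Psi> x)"
  have p: "p \<in> subdiff \<Psi> y" and q: "q \<in> subdiff \<Psi> z" using y z by (auto simp: subdiff_eq_gateaux)
  then have yz: "y \<in> edom \<Psi>" "z \<in> edom \<Psi>" by (auto simp: subdiff_def)
  have "?F y + p (z - y) \<le> ?F z" using p yz by (simp add: subdiff_iff[OF proper])
  moreover have "?F z + q (u - z) \<le> ?F u" if "u \<in> edom \<Psi>" for u
    using q that by (simp add: subdiff_iff[OF proper])
  ultimately have "?F y + q (u - y) \<le> ?F u" if "u \<in> edom \<Psi>" for u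
    using le that by (fastforce simp: blinfun.diff_left blinfun.diff_right)
  then have "q \<in> subdiff \<Psi> y" using yz by (simp add: subdiff_iff[OF proper])
  then show ?thesis using y gateaux_unique by (simp add: subdiff_eq_gateaux)
qed

lemma right_resolvent_eq:
  "sv_monotone T \<Longrightarrow> p \<in> right_resolvent \<Psi> T x \<Longrightarrow> right_resolvent \<Psi> T x = {p}"
  using right_resolvent_unique by blast

lemma single_valued_right_resolvent:
  "sv_monotone T \<Longrightarrow> single_valued_on_dom (right_resolvent \<Psi> T)"
  using right_resolvent_eq unfolding single_valued_on_dom_def sv_dom_def by blast

lemma mem_sv_Fix_right_resolvent_iff:
  assumes "sv_monotone T"
  shows "y \<in> sv_Fix (right_resolvent \<Psi> T) \<longleftrightarrow> (\<exists>z. y \<in> gateaux \<Psi> z \<and> 0 \<in> T z)"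
proof -
  have "y \<in> sv_Fix (right_resolvent \<Psi> T) \<longleftrightarrow> y \<in> right_resolvent \<Psi> T y"
    using right_resolvent_eq[OF assms] by (auto simp: sv_Fix_def)
  then show ?thesis by (simp add: mem_right_resolvent_iff)
qed

lemma sv_Fix_right_resolvent:
  assumes "sv_monotone T"
  shows "sv_Fix (right_resolvent \<Psi> T) = sv_image (gateaux \<Psi>) (interior (edom \<Psi>) \<inter> sv_inv T 0)"
  using mem_sv_Fix_right_resolvent_iff[OF assms]
  by (auto simp: sv_image_def sv_inv_def gateaux_def)

text \<open>With \<open>p\<close> the resolvent value, \<open>a\<close> the point with gradient
  \<open>p\<close> and \<open>b\<close> the one with gradient \<open>y\<close>, the two sides differ
  by exactly \<open>(x - p) (a - b)\<close>, where \<open>x - p \<in> T a\<close> and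
  \<open>0 \<in> T b\<close>.\<close>

lemma dual_bregman_right_resolvent:
  assumes T: "sv_monotone T" and x: "x \<in> interior (edom (conjugate \<Psi>))"
    and p: "x \<in> sv_dom (right_resolvent \<Psi> T)" and y: "y \<in> sv_Fix (right_resolvent \<Psi> T)"
  shows "dual_bregman (conjugate \<Psi>) x (the_elem (right_resolvent \<Psi> T x))
      + dual_bregman (conjugate \<Psi>) (the_elem (right_resolvent \<Psi> T x)) y
    \<le> dual_bregman (conjugate \<Psi>) x y"
proof -
  obtain p where p: "p \<in> right_resolvent \<Psi> T x" using p by (auto simp: sv_dom_def)
  have elem: "the_elem (right_resolvent \<Psi> T x) = p" using right_resolvent_eq[OF T p] by simp
  obtain a where a: "p \<in> gateaux \<Psi> a" "x - p \<in> T a" using p by (auto simp: mem_right_resolvent_iff)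
  obtain b where b: "y \<in> gateaux \<Psi> b" "0 \<in> T b"
    using y by (auto simp: mem_sv_Fix_right_resolvent_iff[OF T])
  have "proper_fun (conjugate \<Psi>)" using proper_conjugateI[OF proper] x interior_subset by blast
  \<comment> \<open>The conjugate values cancel only when finite; \<open>x\<close>, \<open>p\<close>
    and \<open>y\<close> all lie in the interior of the domain.\<close>
  then have finite: "\<exists>r. conjugate \<Psi> v = ereal r" if "v \<in> interior (edom (conjugate \<Psi>))" for v
    using ereal_real_of_proper that interior_subset by (metis subset_iff)
  obtain r s t where "conjugate \<Psi> x = ereal r" "conjugate \<Psi> p = ereal s" "conjugate \<Psi> y = ereal t"
    using finite x gateaux_conjugate_interior a(1) b(1) by metis
  moreover have "0 \<le> (x - p - 0) (a - b)" using T a(2) b(2) unfolding sv_monotone_def by blast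
  ultimately show ?thesis
    by (simp add: dual_bregman_def elem dual_gateaux_eq[OF a(1)] dual_gateaux_eq[OF b(1)]
        blinfun.diff_left blinfun.diff_right)
qed

lemma ran_gateaux_plus_maximally_monotone:
  assumes T: "maximally_monotone T" "sv_graph T \<noteq> {}" "sv_dom T \<subseteq> interior (edom \<Psi>)"
    and dom: "edom (conjugate \<Psi>) = UNIV"
  shows "sv_ran (sv_add (gateaux \<Psi>) T) = UNIV"
proof -
  obtain a a' where a: "a' \<in> T a" using T(2) by (auto simp: sv_graph_def)
  then have "a \<in> interior (edom \<Psi>)" using T(3) by (auto simp: sv_dom_def)
  have "w \<in> sv_ran (sv_add (gateaux \<Psi>) T)" for w
  proof -
    have int: "w - a' \<in> interior (edom (conjugate \<Psi>))" by (simp add: dom)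
    obtain y v where "v \<in> T y" "w - v \<in> subdiff \<Psi> y"
      using maximally_monotone_plus_subdiff_surj[OF reflexive proper convex lower_semicontinuous T(1) a
          \<open>a \<in> interior (edom \<Psi>)\<close> int] .
    then have "w - v + v \<in> sv_add (gateaux \<Psi>) T y"
      unfolding sv_add_def subdiff_eq_gateaux by blast
    then show ?thesis by (auto simp: sv_ran_def)
  qed
  then show ?thesis by blast
qed

end

text \<open>The inclusion of \<open>interior (edom \<Psi>s)\<close> in \<open>sv_dom R\<close>
  guarantees that \<open>the_elem (R x)\<close> is a genuine resolvent value. In the first part the
  values of \<open>R\<close> always lie in that interior, whereas its domain does so under the
  reverse range inclusion; in the second part both sets are the whole dual.\<close>

theorem proposition3p4:
  fixes \<Psi> :: "'a::banach \<Rightarrow> ereal"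
  assumes "reflexive_space TYPE('a)"
    and "\<Psi> \<in> Gamma_G"
    and "strictly_econvex_on (interior (edom \<Psi>)) \<Psi>"
    and "Euler_Legendre \<Psi>"
  shows
    "(\<forall>T :: 'a \<Rightarrow> ('a \<Rightarrow>\<^sub>L real) set.
        sv_graph T \<noteq> {} \<longrightarrow> sv_monotone T \<longrightarrow>
        sv_ran (gateaux \<Psi>) \<subseteq> sv_ran (sv_add (gateaux \<Psi>) T) \<longrightarrow>
        (let R = right_resolvent \<Psi> T; \<Psi>s = conjugate \<Psi> in
          single_valued_on_dom R \<and>
          interior (edom \<Psi>s) \<subseteq> sv_dom R \<and>
          sv_ran R \<subseteq> interior (edom \<Psi>s) \<and>
          (sv_ran (sv_add (gateaux \<Psi>) T) \<subseteq> sv_ran (gateaux \<Psi>) \<longrightarrow>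
             sv_dom R \<subseteq> interior (edom \<Psi>s)) \<and>
          (\<forall>x\<in>interior (edom \<Psi>s). \<forall>y\<in>sv_Fix R.
             dual_bregman \<Psi>s x y \<ge>
               dual_bregman \<Psi>s x (the_elem (R x)) + dual_bregman \<Psi>s (the_elem (R x)) y) \<and>
          sv_Fix R = sv_image (gateaux \<Psi>) (interior (edom \<Psi>) \<inter> sv_inv T 0)))
   \<and> (\<forall>(T :: 'a \<Rightarrow> ('a \<Rightarrow>\<^sub>L real) set) (lam :: real).
        sv_graph T \<noteq> {} \<longrightarrow> maximally_monotone T \<longrightarrow>
        sv_dom T \<subseteq> interior (edom \<Psi>) \<longrightarrow> edom (conjugate \<Psi>) = UNIV \<longrightarrow> 0 < lam \<longrightarrow>
        (let R = right_resolvent \<Psi> (sv_scale lam T); \<Psi>s = conjugate \<Psi> in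
          single_valued_on_dom R \<and>
          interior (edom \<Psi>s) \<subseteq> sv_dom R \<and>
          sv_dom R \<subseteq> interior (edom \<Psi>s) \<and>
          (\<forall>x\<in>interior (edom \<Psi>s). \<forall>y\<in>sv_Fix R.
             dual_bregman \<Psi>s x y \<ge>
               dual_bregman \<Psi>s x (the_elem (R x)) + dual_bregman \<Psi>s (the_elem (R x)) y) \<and>
          sv_Fix R = sv_image (gateaux \<Psi>) (interior (edom \<Psi>) \<inter> sv_inv T 0)))"
proof -
  interpret legendre_function \<Psi> using assms by unfold_locales
  show ?thesis
  proof (intro conjI allI impI)
    fix T :: "'a \<Rightarrow> ('a \<Rightarrow>\<^sub>L real) set"
    assume T: "sv_monotone T" and ran: "sv_ran (gateaux \<Psi>) \<subseteq> sv_ran (sv_add (gateaux \<Psi>) T)"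
    have dom: "interior (edom (conjugate \<Psi>)) \<subseteq> sv_dom (right_resolvent \<Psi> T)"
      using ran by (simp add: sv_dom_right_resolvent ran_gateaux)
    show "let R = right_resolvent \<Psi> T; \<Psi>s = conjugate \<Psi> in
        single_valued_on_dom R \<and> interior (edom \<Psi>s) \<subseteq> sv_dom R \<and> sv_ran R \<subseteq> interior (edom \<Psi>s) \<and>
        (sv_ran (sv_add (gateaux \<Psi>) T) \<subseteq> sv_ran (gateaux \<Psi>) \<longrightarrow> sv_dom R \<subseteq> interior (edom \<Psi>s)) \<and>
        (\<forall>x\<in>interior (edom \<Psi>s). \<forall>y\<in>sv_Fix R. dual_bregman \<Psi>s x y \<ge>
          dual_bregman \<Psi>s x (the_elem (R x)) + dual_bregman \<Psi>s (the_elem (R x)) y) \<and>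
        sv_Fix R = sv_image (gateaux \<Psi>) (interior (edom \<Psi>) \<inter> sv_inv T 0)"
      unfolding Let_def
      using single_valued_right_resolvent[OF T] dom sv_ran_right_resolvent[of T]
        dual_bregman_right_resolvent[OF T] sv_Fix_right_resolvent[OF T]
      by (intro conjI ballI impI) (auto simp: sv_dom_right_resolvent ran_gateaux)
  next
    fix T :: "'a \<Rightarrow> ('a \<Rightarrow>\<^sub>L real) set" and lam :: real
    assume T: "sv_graph T \<noteq> {}" "maximally_monotone T" "sv_dom T \<subseteq> interior (edom \<Psi>)"
      and conj: "edom (conjugate \<Psi>) = UNIV" and lam: "0 < lam"
    let ?T = "sv_scale lam T"
    have max: "maximally_monotone ?T" by (rule maximally_monotone_scale[OF T(2) lam])
    then have mono: "sv_monotone ?T" by (simp add: maximally_monotone_def)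
    have zero: "sv_inv ?T 0 = sv_inv T 0" using lam by (auto simp: sv_inv_def sv_scale_def)
    have "sv_dom (right_resolvent \<Psi> ?T) = UNIV"
      unfolding sv_dom_right_resolvent using T(1,3)
      by (intro ran_gateaux_plus_maximally_monotone max conj)
        (auto simp: sv_graph_def sv_scale_def sv_dom_def)
    then show "let R = right_resolvent \<Psi> ?T; \<Psi>s = conjugate \<Psi> in
        single_valued_on_dom R \<and> interior (edom \<Psi>s) \<subseteq> sv_dom R \<and> sv_dom R \<subseteq> interior (edom \<Psi>s) \<and>
        (\<forall>x\<in>interior (edom \<Psi>s). \<forall>y\<in>sv_Fix R. dual_bregman \<Psi>s x y \<ge>
          dual_bregman \<Psi>s x (the_elem (R x)) + dual_bregman \<Psi>s (the_elem (R x)) y) \<and>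
        sv_Fix R = sv_image (gateaux \<Psi>) (interior (edom \<Psi>) \<inter> sv_inv T 0)"
      unfolding Let_def
      using single_valued_right_resolvent[OF mono] conj
        dual_bregman_right_resolvent[OF mono] sv_Fix_right_resolvent[OF mono]
      by (intro conjI ballI) (auto simp: zero)
  qed
qed

end
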